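(* Let $n\ge 3$ and let $I\in\mathbb{C}\mathrm{P}^n$ be a fixed point. The fundamental group of the space $\mathcal{D}_I^{3,n}$ of non-planar Desargues configurations in $\mathbb{C}\mathrm{P}^n$ with fixed intersection point $I$ is $$\pi_1(\mathcal{D}_{I}^{3,n})\cong\begin{cases}\mathbb{Z} & \text{if } n=3,\\ 1 & \text{if } n\geq 4.\end{cases}$$
   Context: For six points $A_1,B_1,A_2,B_2,A_3,B_3\in\mathbb{C}\mathrm{P}^n$ with $A_i\neq B_i$, let $d_i$ denote the projective line through $A_i$ and $B_i$. For $n\ge 3$, $\mathcal{D}^{3,n}$ is the set of 6-tuples $(A_1,B_1,A_2,B_2,A_3,B_3)$ of pairwise distinct points of $\mathbb{C}\mathrm{P}^n$ such that: the six points span a projective subspace of dimension $3$; $d_1\cap d_2\cap d_3$ is a single point; and $A_i,B_i\in d_i\setminus(d_1\cap d_2\cap d_3)$ for $i=1,2,3$. For a fixed point $I\in\mathbb{C}\mathrm{P}^n$, $\mathcal{D}_I^{3,n}$ is the subset of $\mathcal{D}^{3,n}$ of those configurations with $d_1\cap d_2\cap d_3=\{I\}$. Both have the subspace topology from $(\mathbb{C}\mathrm{P}^n)^6$. Here $1$ denotes the trivial group. *)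

theory Defs
  imports "HOL-Analysis.Analysis" "HOL-Algebra.Elementary_Groups"
begin

(* Points of the projective space of complex^'n are the lines through the origin,
   so 'n cproj is complex projective n-space for n = CARD('n) - 1. Here vec.subspace,
   vec.span and vec.dim refer to the scalar action *s of the complex field, i.e. they
   are the complex (not the real) linear notions. *)

typedef (overloaded) 'n cproj =
  "{L :: (complex ^ 'n::finite) set. vec.subspace L \<and> vec.dim L = 1}"
  morphisms vline Abs_cproj
proof -
  obtain i :: 'n where True by simp
  have "vec.dim {axis i (1::complex)} = 1"
    by (subst vec.dim_eq_card_independent) (simp_all add: axis_eq_0_iff)
  then have "vec.dim (vec.span {axis i (1::complex)}) = 1" by simp
  then show ?thesis using vec.subspace_span by blast
qed

definition cproj_point :: "complex ^ 'n \<Rightarrow> 'n::finite cproj" where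
  "cproj_point v = Abs_cproj (vec.span {v})"

(* The quotient topology of complex^'n - {0}, under the map sending a nonzero vector
   to the line it spans. *)
instantiation cproj :: (finite) topological_space
begin

definition open_cproj :: "'a cproj set \<Rightarrow> bool" where
  "open_cproj U \<longleftrightarrow> open {v :: complex ^ 'a. v \<noteq> 0 \<and> cproj_point v \<in> U}"

instance
proof
  show "open (UNIV :: 'a cproj set)"
  proof -
    have "{v :: complex ^ 'a. v \<noteq> 0 \<and> cproj_point v \<in> UNIV} = - {0}" by auto
    then show ?thesis unfolding open_cproj_def by (simp add: open_Compl)
  qed
next
  fix S T :: "'a cproj set"
  assume "open S" "open T"
  moreover have "{v :: complex ^ 'a. v \<noteq> 0 \<and> cproj_point v \<in> S \<inter> T} =
      {v. v \<noteq> 0 \<and> cproj_point v \<in> S} \<inter> {v. v \<noteq> 0 \<and> cproj_point v \<in> T}"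
    by auto
  ultimately show "open (S \<inter> T)"
    unfolding open_cproj_def by (simp add: open_Int)
next
  fix K :: "'a cproj set set"
  assume K: "\<forall>S\<in>K. open S"
  have "{v :: complex ^ 'a. v \<noteq> 0 \<and> cproj_point v \<in> \<Union>K} =
      (\<Union>S\<in>K. {v. v \<noteq> 0 \<and> cproj_point v \<in> S})"
    by auto
  then show "open (\<Union>K)"
    using K unfolding open_cproj_def by (simp add: open_UN)
qed

end

definition proj_cone :: "'n::finite cproj set \<Rightarrow> (complex ^ 'n) set" where
  "proj_cone S = (\<Union>X\<in>S. vline X)"

definition proj_span :: "'n::finite cproj set \<Rightarrow> 'n cproj set" where
  "proj_span S = {X. vline X \<subseteq> vec.span (proj_cone S)}"

definition proj_dim :: "'n::finite cproj set \<Rightarrow> int" where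
  "proj_dim L = int (vec.dim (proj_cone L)) - 1"

definition proj_line :: "'n::finite cproj \<Rightarrow> 'n cproj \<Rightarrow> 'n cproj set" where
  "proj_line A B = proj_span {A, B}"

type_synonym 'n six_points =
  "'n cproj \<times> 'n cproj \<times> 'n cproj \<times> 'n cproj \<times> 'n cproj \<times> 'n cproj"

(* Non-planar Desargues configurations, ordered as (A1, B1, A2, B2, A3, B3). *)
definition desargues3 :: "'n::finite six_points set" where
  "desargues3 = {(A1, B1, A2, B2, A3, B3).
     distinct [A1, B1, A2, B2, A3, B3] \<and>
     proj_dim (proj_span {A1, B1, A2, B2, A3, B3}) = 3 \<and>
     (let d1 = proj_line A1 B1; d2 = proj_line A2 B2; d3 = proj_line A3 B3;
          P = d1 \<inter> d2 \<inter> d3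
      in is_singleton P \<and>
         {A1, B1} \<subseteq> d1 - P \<and> {A2, B2} \<subseteq> d2 - P \<and> {A3, B3} \<subseteq> d3 - P)}"

definition desargues3_at :: "'n::finite cproj \<Rightarrow> 'n six_points set" where
  "desargues3_at I = {(A1, B1, A2, B2, A3, B3).
     (A1, B1, A2, B2, A3, B3) \<in> desargues3 \<and>
     proj_line A1 B1 \<inter> proj_line A2 B2 \<inter> proj_line A3 B3 = {I}}"

definition loops_at :: "'a::topological_space set \<Rightarrow> 'a \<Rightarrow> (real \<Rightarrow> 'a) set" where
  "loops_at S a = {p. path p \<and> path_image p \<subseteq> S \<and> pathstart p = a \<and> pathfinish p = a}"

(* S carries the subspace topology. homotopic_paths is homotopy inside S relative to
   the endpoints; it ignores values of paths outside {0..1}. *)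
definition fundamental_group ::
    "'a::topological_space set \<Rightarrow> 'a \<Rightarrow> (real \<Rightarrow> 'a) set monoid" where
  "fundamental_group S a =
     \<lparr>carrier = loops_at S a // {(p, q). homotopic_paths S p q},
      monoid.mult = (\<lambda>P Q. {r. \<exists>p\<in>P. \<exists>q\<in>Q. homotopic_paths S (p +++ q) r}),
      one = {r. homotopic_paths S (\<lambda>_. a) r}\<rparr>"

end

theory Submission
  imports Defs "HOL-Complex_Analysis.Complex_Analysis"
begin

text \<open>
  Write \<open>V\<close> for the vector space \<^typ>\<open>complex ^ 'n\<close> and choose a vector \<open>e\<close> spanning \<open>I\<close>. If \<open>A\<close> and \<open>B\<close>
  are distinct points, both different from \<open>I\<close>, on a line through \<open>I\<close>, then there is exactly one
  vector \<open>a\<close> such that \<open>A\<close> is the class of \<open>a\<close> and \<open>B\<close> is the class of \<open>a + e\<close>. So a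
  configuration with centre \<open>I\<close> is the same as a triple \<open>(a, b, c)\<close> of vectors, and it is non-planar
  exactly if \<open>e, a, b, c\<close> are linearly independent. This identifies the space of configurations with
  the open set \<open>frames e\<close> of all such triples (\<open>desargues3_at_eq\<close>, \<open>continuous_configuration\<close>,
  \<open>continuous_directions\<close>); up to a contractible factor it is the space of linearly independent
  triples in \<open>V / I\<close>. All homotopies take place in \<open>frames e\<close>.

  After a polynomial approximation a loop \<open>(x, y, z)\<close> in \<open>frames e\<close> is smooth. The span of \<open>k\<close> smooth
  curves in \<open>V\<close>, taken over all parameters, is the smooth image of a space of real dimension
  \<open>2 k + 1\<close>, so it has measure zero if \<open>k < dim V\<close>: some vector avoids all these spans
  (\<open>avoid_spans_of_curves\<close>).

  If \<open>dim V > 4\<close>, some \<open>a\<close> is never in the span of \<open>e, x, y, z\<close>, and the first entry can be moved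
  along segments to \<open>a\<close>. Repeating this for the other two entries makes the loop constant
  (\<open>loop_in_frames_null_homotopic\<close>).

  If \<open>dim V = 4\<close>, the determinant of \<open>e, a, b, c\<close> maps \<open>frames e\<close> to the punctured plane, and the
  winding number of its values is an invariant of loops. There is only room to avoid the span of
  three curves. Let \<open>w\<close> never be in the span of \<open>e, y, z\<close>. By Cramer's rule the coefficient of \<open>x\<close>
  in the expansion of \<open>w\<close> is a continuous nowhere vanishing function, and adding multiples of
  entries to other entries, a kind of Gaussian elimination depending on the parameter, turns the
  second entry into \<open>w\<close> (\<open>make_second_constant\<close>). The third entry is made constant in the same way,
  and the loop becomes \<open>(\<kappa> a, b, c)\<close> with fixed \<open>a, b, c\<close> and a loop \<open>\<kappa>\<close> of nonzero numbers
  (\<open>homotopic_to_scaled_frame\<close>). Its determinant is a constant multiple of \<open>\<kappa>\<close>, so a loop with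
  winding number zero is null-homotopic. The loops with \<open>\<kappa> = exp (2 \<pi> \<i> m t)\<close> show that every integer
  occurs as a winding number.
\<close>

section \<open>Recognising fundamental groups\<close>

definition path_class :: "'a::topological_space set \<Rightarrow> (real \<Rightarrow> 'a) \<Rightarrow> (real \<Rightarrow> 'a) set" where
  "path_class S p = {q. homotopic_paths S p q}"

lemma loops_at_iff:
  "p \<in> loops_at S a \<longleftrightarrow> path p \<and> path_image p \<subseteq> S \<and> pathstart p = a \<and> pathfinish p = a"
  by (simp add: loops_at_def)

lemma path_class_self: "p \<in> loops_at S a \<Longrightarrow> p \<in> path_class S p"
  by (simp add: path_class_def loops_at_iff homotopic_paths_refl)

lemma path_class_eqI: "homotopic_paths S p q \<Longrightarrow> path_class S p = path_class S q"
  unfolding path_class_def using homotopic_paths_trans homotopic_paths_sym by blast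

lemma loops_at_join: "p \<in> loops_at S a \<Longrightarrow> q \<in> loops_at S a \<Longrightarrow> p +++ q \<in> loops_at S a"
  by (simp add: loops_at_iff subset_path_image_join)

lemma carrier_fundamental_group:
  "carrier (fundamental_group S a) = path_class S ` loops_at S a"
  by (auto simp: fundamental_group_def quotient_def path_class_def)

lemma mult_path_class:
  assumes "p \<in> loops_at S a" "q \<in> loops_at S a"
  shows "path_class S p \<otimes>\<^bsub>fundamental_group S a\<^esub> path_class S q = path_class S (p +++ q)"
proof -
  have "homotopic_paths S (p +++ q) r"
    if "homotopic_paths S p p'" "homotopic_paths S q q'" "homotopic_paths S (p' +++ q') r" for p' q' r
    using homotopic_paths_join [OF that(1,2)] that(3) assms homotopic_paths_trans
    by (auto simp: loops_at_iff)
  then have "path_class S p \<otimes>\<^bsub>fundamental_group S a\<^esub> path_class S q \<subseteq> path_class S (p +++ q)"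
    by (auto simp: fundamental_group_def path_class_def)
  moreover have "r \<in> path_class S p \<otimes>\<^bsub>fundamental_group S a\<^esub> path_class S q"
    if "r \<in> path_class S (p +++ q)" for r
    unfolding fundamental_group_def monoid.simps mem_Collect_eq
    using that by (intro bexI [OF _ path_class_self [OF assms(1)]] bexI [OF _ path_class_self [OF assms(2)]])
      (simp add: path_class_def)
  ultimately show ?thesis by blast
qed

lemma trivial_fundamental_group:
  assumes "a \<in> S"
    and "\<And>p q. p \<in> loops_at S a \<Longrightarrow> q \<in> loops_at S a \<Longrightarrow> homotopic_paths S p q"
  shows "trivial_group (fundamental_group S a)"
proof -
  let ?G = "fundamental_group S a"
  define k where "k = (\<lambda>_::real. a)"
  have k: "k \<in> loops_at S a"
    using \<open>a \<in> S\<close> by (auto simp: k_def loops_at_iff path_def path_image_def pathstart_def pathfinish_def)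
  have one: "\<one>\<^bsub>?G\<^esub> = path_class S k"
    by (simp add: fundamental_group_def path_class_def k_def)
  have carrier: "carrier ?G = {path_class S k}"
    using k assms(2) path_class_eqI by (fastforce simp: carrier_fundamental_group)
  have "path_class S k \<otimes>\<^bsub>?G\<^esub> path_class S k = path_class S k"
    using assms(2) k loops_at_join path_class_eqI by (metis mult_path_class)
  then have "group ?G"
    by (intro groupI) (auto simp: carrier one)
  then show ?thesis by (simp add: trivial_group_def carrier one)
qed

text \<open>
  The degree of a class is the winding number about the origin of the image under \<open>d\<close> of any loop in
  the class. Homotopy invariance makes it well defined, and the winding number of a join is
  the sum of the winding numbers, so it is a homomorphism; the two hypotheses make it bijective.
\<close>

lemma fundamental_group_iso_integer_group:
  fixes d :: "'a::topological_space \<Rightarrow> complex"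
  assumes d: "continuous_on S d" "d ` S \<subseteq> - {0}"
    and inj: "\<And>p q. p \<in> loops_at S a \<Longrightarrow> q \<in> loops_at S a \<Longrightarrow>
      winding_number (d \<circ> p) 0 = winding_number (d \<circ> q) 0 \<Longrightarrow> homotopic_paths S p q"
    and surj: "\<And>k::int. \<exists>p\<in>loops_at S a. winding_number (d \<circ> p) 0 = of_int k"
  shows "fundamental_group S a \<cong> integer_group"
proof -
  let ?G = "fundamental_group S a"
  \<comment> \<open>The winding number of a loop is an integer, so the floor only changes its type.\<close>
  define deg where "deg P = \<lfloor>Re (winding_number (d \<circ> (SOME p. p \<in> P)) 0)\<rfloor>" for P
  have loop: "path (d \<circ> p)" "0 \<notin> path_image (d \<circ> p)"
      "pathstart (d \<circ> p) = d a" "pathfinish (d \<circ> p) = d a"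
    if "p \<in> loops_at S a" for p
    using that d by (auto simp: loops_at_iff path_image_compose pathstart_compose pathfinish_compose
        intro!: path_continuous_image elim: continuous_on_subset)
  have deg: "of_int (deg (path_class S p)) = winding_number (d \<circ> p) 0" if p: "p \<in> loops_at S a" for p
  proof -
    define q where "q = (SOME q. q \<in> path_class S p)"
    have "q \<in> path_class S p"
      unfolding q_def by (rule someI [where P = "\<lambda>q. q \<in> path_class S p", OF path_class_self[OF p]])
    then have "homotopic_paths (- {0}) (d \<circ> p) (d \<circ> q)"
      unfolding path_class_def using d by (auto intro!: homotopic_paths_continuous_image)
    then have "winding_number (d \<circ> q) 0 = winding_number (d \<circ> p) 0"
      by (simp add: winding_number_homotopic_paths)
    moreover have "winding_number (d \<circ> p) 0 \<in> \<int>"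
      using integer_winding_number loop[OF p] by auto
    ultimately show ?thesis
      unfolding deg_def q_def [symmetric] by (auto elim: Ints_cases)
  qed
  have eqI: "k = l" if "of_int k = (of_int l :: complex)" for k l :: int
    using that by simp
  have "deg \<in> hom ?G integer_group"
  proof (rule homI)
    fix P Q assume "P \<in> carrier ?G" "Q \<in> carrier ?G"
    then obtain p q where pq: "p \<in> loops_at S a" "q \<in> loops_at S a"
      and PQ: "P = path_class S p" "Q = path_class S q"
      by (auto simp: carrier_fundamental_group)
    have "winding_number (d \<circ> (p +++ q)) 0 = winding_number (d \<circ> p) 0 + winding_number (d \<circ> q) 0"
      using loop[OF pq(1)] loop[OF pq(2)] by (simp add: path_compose_join winding_number_join)
    then have "of_int (deg (path_class S (p +++ q))) = (of_int (deg P + deg Q) :: complex)"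
      unfolding of_int_add PQ deg [OF pq(1)] deg [OF pq(2)] deg [OF loops_at_join [OF pq]] .
    then have "deg (path_class S (p +++ q)) = deg P + deg Q"
      by (rule eqI)
    then show "deg (P \<otimes>\<^bsub>?G\<^esub> Q) = deg P \<otimes>\<^bsub>integer_group\<^esub> deg Q"
      by (simp add: PQ mult_path_class pq)
  qed simp
  moreover have "inj_on deg (carrier ?G)"
  proof (rule inj_onI)
    fix P Q assume "P \<in> carrier ?G" "Q \<in> carrier ?G" and eq: "deg P = deg Q"
    then obtain p q where pq: "p \<in> loops_at S a" "q \<in> loops_at S a"
      and PQ: "P = path_class S p" "Q = path_class S q"
      by (auto simp: carrier_fundamental_group)
    have "winding_number (d \<circ> p) 0 = winding_number (d \<circ> q) 0"
      using deg [OF pq(1)] deg [OF pq(2)] eq PQ by simp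
    then show "P = Q"
      using inj pq PQ path_class_eqI by metis
  qed

  moreover have "deg ` carrier ?G = UNIV"
  proof -
    have "k \<in> deg ` carrier ?G" for k
    proof -
      obtain p where p: "p \<in> loops_at S a" "winding_number (d \<circ> p) 0 = of_int k"
        using surj by blast
      have "k = deg (path_class S p)"
        by (rule eqI) (simp only: deg [OF p(1)] p(2))
      then show ?thesis
        using p by (auto simp: carrier_fundamental_group)
    qed
    then show ?thesis by auto
  qed
  ultimately have "deg \<in> iso ?G integer_group"
    by (simp add: iso_def bij_betw_def)
  then show ?thesis by (auto simp: is_iso_def)
qed

text \<open>
  With the next lemma this reduces homotopies between loops of projective points, which do not lie in a
  vector space, to null-homotopies of single loops in a normed space.
\<close>

lemma homotopic_paths_if_image_homotopic:
  assumes f: "continuous_on S f" "f ` S \<subseteq> T" and g: "continuous_on T g" "g ` T \<subseteq> S"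
    and gf: "\<And>x. x \<in> S \<Longrightarrow> g (f x) = x"
    and p: "path p" "path_image p \<subseteq> S" and q: "path q" "path_image q \<subseteq> S"
    and h: "homotopic_paths T (f \<circ> p) (f \<circ> q)"
  shows "homotopic_paths S p q"
proof -
  have round_trip: "homotopic_paths S r (g \<circ> (f \<circ> r))" if r: "path r" "path_image r \<subseteq> S" for r
  proof (rule homotopic_paths_eq [OF r])
    fix t :: real assume "t \<in> {0..1}"
    then have "r t \<in> S" using r(2) by (auto simp: path_image_def)
    then show "r t = (g \<circ> (f \<circ> r)) t" by (simp add: gf)
  qed
  have "homotopic_paths S (g \<circ> (f \<circ> p)) (g \<circ> (f \<circ> q))"
    using g(2) by (intro homotopic_paths_continuous_image [OF h g(1)]) auto
  then show ?thesis
    using round_trip [OF p] round_trip [OF q] homotopic_paths_trans homotopic_paths_sym by metis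
qed

lemma homotopic_paths_if_difference_null:
  fixes p q :: "real \<Rightarrow> 'a::real_normed_vector"
  assumes "path q" "homotopic_loops S (p +++ reversepath q) (\<lambda>_. m)"
  shows "homotopic_paths S p q"
  using homotopic_paths_loop_parts [of S p q m] assms by (simp add: linepath_refl)

section \<open>Vectors outside the spans of curves\<close>

lemma continuous_smult:
  fixes f :: "'a::topological_space \<Rightarrow> complex" and g :: "'a \<Rightarrow> complex ^ 'n::finite"
  assumes "continuous_on S f" "continuous_on S g"
  shows "continuous_on S (\<lambda>x. f x *s g x)"
  unfolding vector_scalar_mult_def
  by (intro continuous_intros continuous_on_vec_lambda assms)

lemma scaleR_eq_smult: "r *\<^sub>R (v :: complex ^ 'n) = complex_of_real r *s v"
  by (simp add: vec_eq_iff scaleR_conv_of_real [where 'a = complex])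

lemma span_range_coefficients:
  fixes F :: "'k::finite \<Rightarrow> complex ^ 'n::finite"
  assumes "w \<in> vec.span (range F)"
  obtains c :: "complex ^ 'k" where "w = (\<Sum>k\<in>UNIV. (c $ k) *s F k)"
proof -
  let ?T = "range (\<lambda>c :: complex ^ 'k. \<Sum>k\<in>UNIV. (c $ k) *s F k)"
  have "vec.subspace ?T"
  proof (rule vec.subspaceI)
    show "0 \<in> ?T" by (rule range_eqI [where x = 0]) simp
  next
    fix x y assume "x \<in> ?T" "y \<in> ?T"
    then obtain c d where "x = (\<Sum>k\<in>UNIV. (c $ k) *s F k)" "y = (\<Sum>k\<in>UNIV. (d $ k) *s F k)" by auto
    then show "x + y \<in> ?T"
      by (intro range_eqI [where x = "c + d"]) (simp add: sum.distrib vec.scale_left_distrib)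
  next
    fix r x assume "x \<in> ?T"
    then obtain c where "x = (\<Sum>k\<in>UNIV. (c $ k) *s F k)" by auto
    then show "r *s x \<in> ?T"
      by (intro range_eqI [where x = "r *s c"]) (simp add: vec.scale_sum_right)
  qed
  moreover have "range F \<subseteq> ?T"
  proof clarify
    fix i
    have "F i = (\<Sum>k\<in>UNIV. (axis i 1 $ k) *s F k)"
      by (simp add: axis_def if_distrib [where f = "\<lambda>x. x *s _"] cong: if_cong)
    then show "F i \<in> ?T" by blast
  qed
  ultimately have "w \<in> ?T"
    using assms vec.span_minimal by blast
  then show ?thesis using that by blast
qed

text \<open>
  The union of the spans is the image of \<open>{0..1} \<times> complex ^ 'k\<close> under a differentiable map, and the real
  dimension \<open>1 + 2 CARD('k)\<close> of the source is smaller than \<open>2 CARD('n)\<close>. So the union has measure zero.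
\<close>

lemma avoid_spans_of_curves:
  fixes F :: "'k::finite \<Rightarrow> real \<Rightarrow> complex ^ 'n::finite"
  assumes card: "CARD('k) < CARD('n)"
    and diff: "\<And>k. F k differentiable_on {0..1}"
  obtains w where "\<And>t. t \<in> {0..1} \<Longrightarrow> w \<notin> vec.span (range (\<lambda>k. F k t))"
proof -
  define G :: "real \<times> (complex ^ 'k) \<Rightarrow> complex ^ 'n"
    where "G = (\<lambda>(t, c). \<Sum>k\<in>UNIV. (c $ k) *s F k t)"
  let ?D = "{0..1::real} \<times> (UNIV :: (complex ^ 'k) set)"
  have "(\<lambda>x. (snd x $ k) *s F k (fst x)) differentiable_on ?D" for k
  proof -
    have F: "(\<lambda>x. F k (fst x)) differentiable_on ?D"
    proof -
      have "(F k \<circ> fst) differentiable_on ?D"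
        unfolding differentiable_on_def
      proof
        fix x :: "real \<times> (complex ^ 'k)" assume x: "x \<in> ?D"
        have "fst differentiable at x within ?D"
          by (intro bounded_linear_imp_differentiable bounded_linear_fst)
        moreover have "F k differentiable at (fst x) within fst ` ?D"
          using diff x by (auto simp: differentiable_on_def)
        ultimately show "F k \<circ> fst differentiable at x within ?D"
          by (rule differentiable_chain_within)
      qed
      then show ?thesis by (simp add: o_def)
    qed
    have bil: "bounded_bilinear (\<lambda>(c::complex) (v::complex ^ 'n). c *s v)"
    proof -
      have "\<exists>K. \<forall>(a::complex) (b::complex ^ 'n). norm (a *s b) \<le> norm a * norm b * K"
        by (rule exI [where x = 1])
           (simp add: norm_vec_def L2_set_def norm_mult power_mult_distrib
             flip: sum_distrib_left, simp add: real_sqrt_mult)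
      then show ?thesis
        by (intro bounded_bilinear.intro)
           (auto simp: vec.scale_left_distrib vec.scale_right_distrib vec_eq_iff)
    qed
    have c: "(\<lambda>x. snd x $ k) differentiable_on ?D"
      unfolding differentiable_on_def
      by (intro ballI bounded_linear_imp_differentiable
            bounded_linear_compose [OF bounded_linear_vec_nth bounded_linear_snd])
    show ?thesis
      using F c bounded_bilinear.FDERIV [OF bil]
      unfolding differentiable_on_def differentiable_def by blast
  qed
  then have "G differentiable_on ?D"
    unfolding G_def case_prod_unfold by (auto simp: differentiable_on_def intro!: differentiable_sum)
  moreover have "DIM(real \<times> (complex ^ 'k)) < DIM(complex ^ 'n)"
    using card by simp
  ultimately have "negligible (G ` ({0..1} \<times> UNIV))"
    using negligible_differentiable_image_lowdim by blast
  then have "G ` ({0..1} \<times> UNIV) \<noteq> UNIV"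
    using non_negligible_UNIV by metis
  then obtain w where w: "w \<notin> G ` ({0..1} \<times> UNIV)" by blast
  show ?thesis
  proof
    fix t :: real assume t: "t \<in> {0..1}"
    show "w \<notin> vec.span (range (\<lambda>k. F k t))"
    proof
      assume "w \<in> vec.span (range (\<lambda>k. F k t))"
      then obtain c where "w = G (t, c)"
        by (auto simp: G_def elim: span_range_coefficients)
      then show False using w t by blast
    qed
  qed
qed

text \<open>
  The type \<^typ>\<open>bool option\<close> is an index set with three elements; \<^typ>\<open>bool option option\<close> in the
  lemma after this one has four.
\<close>

lemma avoid_spans_of_3_curves:
  fixes u v w :: "real \<Rightarrow> complex ^ 'n::finite"
  assumes "CARD('n) > 3" "u differentiable_on {0..1}" "v differentiable_on {0..1}" "w differentiable_on {0..1}"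
  obtains a where "\<And>t. t \<in> {0..1} \<Longrightarrow> a \<notin> vec.span {u t, v t, w t}"
proof -
  define F where "F = (\<lambda>k :: bool option. case k of None \<Rightarrow> u | Some b \<Rightarrow> if b then w else v)"
  have r: "range (\<lambda>k. F k t) = {u t, v t, w t}" for t
    by (simp add: F_def UNIV_option_conv UNIV_bool)
  have "F k differentiable_on {0..1}" for k
    using assms by (simp add: F_def split: option.split)
  moreover have "CARD(bool option) < CARD('n)"
    using assms by (simp add: UNIV_option_conv UNIV_bool)
  ultimately show ?thesis
    using that avoid_spans_of_curves [of F] unfolding r by metis
qed

lemma avoid_spans_of_4_curves:
  fixes u v w z :: "real \<Rightarrow> complex ^ 'n::finite"
  assumes "CARD('n) > 4" "u differentiable_on {0..1}" "v differentiable_on {0..1}"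
    "w differentiable_on {0..1}" "z differentiable_on {0..1}"
  obtains a where "\<And>t. t \<in> {0..1} \<Longrightarrow> a \<notin> vec.span {u t, v t, w t, z t}"
proof -
  define F where "F = (\<lambda>k :: bool option option.
    case k of None \<Rightarrow> u | Some None \<Rightarrow> v | Some (Some b) \<Rightarrow> if b then z else w)"
  have r: "range (\<lambda>k. F k t) = {u t, v t, w t, z t}" for t
    by (simp add: F_def UNIV_option_conv UNIV_bool)
  have "F k differentiable_on {0..1}" for k
    using assms by (simp add: F_def split: option.split)
  moreover have "CARD(bool option option) < CARD('n)"
    using assms by (simp add: UNIV_option_conv UNIV_bool)
  ultimately show ?thesis
    using that avoid_spans_of_curves [of F] unfolding r by metis
qed

section \<open>The space of frames\<close>

lemma span_eq_UNIV_of_dim: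
  fixes S :: "(complex ^ 'n::finite) set"
  assumes "vec.dim S = CARD('n)"
  shows "vec.span S = UNIV"
  using assms by (metis vec.dim_eq_span [of S UNIV] subset_UNIV vec.span_UNIV vec_dim_card order_refl)

text \<open>
  The dimension is counted because \<open>vec.independent {e, a, b, c}\<close> would accept repeated vectors.
\<close>

definition frames :: "complex ^ 'n::finite \<Rightarrow> ((complex ^ 'n) \<times> (complex ^ 'n) \<times> (complex ^ 'n)) set" where
  "frames e = {(a, b, c). vec.dim {e, a, b, c} = 4}"

lemma dim_insert_eq_4:
  "vec.dim (insert x {u, v, w :: complex ^ 'n::finite}) = 4 \<longleftrightarrow>
    vec.dim {u, v, w} = 3 \<and> x \<notin> vec.span {u, v, w}"
proof -
  have "vec.dim {u, v, w} \<le> 3" by (simp add: vec.dim_insert)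
  then show ?thesis by (subst vec.dim_insert) auto
qed

lemma frames_first: "(a, b, c) \<in> frames e \<longleftrightarrow> vec.dim {e, b, c} = 3 \<and> a \<notin> vec.span {e, b, c}"
  using dim_insert_eq_4 [of a e b c] by (simp add: frames_def insert_commute)

lemma frames_second: "(a, b, c) \<in> frames e \<longleftrightarrow> vec.dim {e, a, c} = 3 \<and> b \<notin> vec.span {e, a, c}"
  using dim_insert_eq_4 [of b e a c] by (simp add: frames_def insert_commute)

lemma frames_third: "(a, b, c) \<in> frames e \<longleftrightarrow> vec.dim {e, a, b} = 3 \<and> c \<notin> vec.span {e, a, b}"
  using dim_insert_eq_4 [of c e a b] by (simp add: frames_def insert_commute)

lemma frames_swap: "(a, b, c) \<in> frames e \<longleftrightarrow> (a, c, b) \<in> frames e"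
  by (simp add: frames_def insert_commute)

lemma frames_swap_first: "(a, b, c) \<in> frames e \<longleftrightarrow> (b, a, c) \<in> frames e"
  by (simp add: frames_def insert_commute)

lemma frames_scale_first:
  assumes "(a, b, c) \<in> frames e" "k \<noteq> 0"
  shows "(k *s a, b, c) \<in> frames e"
proof -
  have "a = (1 / k) *s (k *s a)" using assms(2) by simp
  then have "a \<in> vec.span {e, b, c}" if "k *s a \<in> vec.span {e, b, c}"
    using that vec.span_scale by metis
  then show ?thesis using assms(1) by (auto simp: frames_first)
qed

lemma frames_add_first:
  assumes "(a, b, c) \<in> frames e" "r \<in> vec.span {e, b, c}"
  shows "(a + r, b, c) \<in> frames e"
  using assms by (auto simp: frames_first dest: vec.span_diff)

text \<open>
  Unlike the dimension, the equation on the left of the implication is a closed condition on the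
  coefficients and the vectors jointly, which makes it suitable for topological arguments.
\<close>

lemma frames_iff_no_relation:
  "(a, b, c) \<in> frames e \<longleftrightarrow>
    (\<forall>k l m n. k *s e + l *s a + m *s b + n *s c = 0 \<longrightarrow> (k, l, m, n) = 0)"
proof -
  have frames: "(a, b, c) \<in> frames e \<longleftrightarrow> c \<noteq> 0 \<and> b \<notin> vec.span {c} \<and> a \<notin> vec.span {b, c} \<and> e \<notin> vec.span {a, b, c}"
    unfolding frames_def by (simp add: vec.dim_insert)
  note span = vec.span_breakdown_eq vec.span_empty singleton_iff
  show ?thesis
  proof
    assume *: "(a, b, c) \<in> frames e"
    show "\<forall>k l m n. k *s e + l *s a + m *s b + n *s c = 0 \<longrightarrow> (k, l, m, n) = 0"
    proof (intro allI impI)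
      fix k l m n assume rel: "k *s e + l *s a + m *s b + n *s c = 0"
      have "k = 0"
      proof (rule ccontr)
        assume "k \<noteq> 0"
        then have "e - (- l / k) *s a - (- m / k) *s b - (- n / k) *s c = (1 / k) *s (k *s e + l *s a + m *s b + n *s c)"
          by (simp add: vec_eq_iff field_simps)
        then show False using * unfolding frames span rel by (metis vec.scale_zero_right)
      qed
      moreover have "l = 0" if "k = 0"
      proof (rule ccontr)
        assume "l \<noteq> 0"
        then have "a - (- m / l) *s b - (- n / l) *s c = (1 / l) *s (k *s e + l *s a + m *s b + n *s c)"
          using that by (simp add: vec_eq_iff field_simps)
        then show False using * unfolding frames span rel by (metis vec.scale_zero_right)
      qed
      moreover have "m = 0" if "k = 0" "l = 0"
      proof (rule ccontr)
        assume "m \<noteq> 0"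
        then have "b - (- n / m) *s c = (1 / m) *s (k *s e + l *s a + m *s b + n *s c)"
          using that by (simp add: vec_eq_iff field_simps)
        then show False using * unfolding frames span rel by (metis vec.scale_zero_right)
      qed
      moreover have "n = 0" if "k = 0" "l = 0" "m = 0"
        using rel that * frames by simp
      ultimately show "(k, l, m, n) = 0" by (auto simp: zero_prod_def)
    qed
  next
    assume *: "\<forall>k l m n. k *s e + l *s a + m *s b + n *s c = 0 \<longrightarrow> (k, l, m, n) = 0"
    have "c \<noteq> 0" using * [rule_format, of 0 0 0 1] by (auto simp: zero_prod_def)
    moreover have "b - k *s c \<noteq> 0" for k
      using * [rule_format, of 0 0 1 "- k"] by (auto simp: zero_prod_def)
    moreover have "a - l *s b - k *s c \<noteq> 0" for k l
      using * [rule_format, of 0 1 "- l" "- k"] by (auto simp: zero_prod_def)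
    moreover have "e - m *s a - l *s b - k *s c \<noteq> 0" for k l m
      using * [rule_format, of 1 "- m" "- l" "- k"] by (auto simp: zero_prod_def)
    ultimately show "(a, b, c) \<in> frames e" unfolding frames span by blast
  qed
qed

text \<open>
  A linear relation can be scaled to have coefficients on the unit sphere. Hence the complement of
  \<open>frames e\<close> is the projection of a closed set along a compact one, and so closed.
\<close>

lemma open_frames: "open (frames e)" for e :: "complex ^ 'n::finite"
proof -
  define R :: "(complex \<times> complex \<times> complex \<times> complex) \<times> (complex ^ 'n) \<times> (complex ^ 'n) \<times> (complex ^ 'n) \<Rightarrow> complex ^ 'n"
    where "R = (\<lambda>((k, l, m, n), (a, b, c)). k *s e + l *s a + m *s b + n *s c)"
  have R_scale: "R (r *\<^sub>R x, y) = complex_of_real r *s R (x, y)" for r x y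
    by (cases x; cases y)
       (simp add: R_def scaleR_conv_of_real vec.scale_right_distrib)
  have frames: "y \<in> frames e \<longleftrightarrow> (\<forall>x. R (x, y) = 0 \<longrightarrow> x = 0)" for y
    by (cases y) (simp add: frames_iff_no_relation R_def zero_prod_def)
  have "continuous_on UNIV R"
    unfolding R_def case_prod_unfold by (intro continuous_intros continuous_smult)
  then have "closed {x. R x = 0}"
    by (intro closed_Collect_eq) auto
  then have "closed {y. \<exists>x. x \<in> sphere 0 1 \<and> (x, y) \<in> {x. R x = 0}}"
    by (intro closed_compact_projection) auto
  also have "{y. \<exists>x. x \<in> sphere 0 1 \<and> (x, y) \<in> {x. R x = 0}} = - frames e"
  proof -
    have "\<exists>x'. norm x' = 1 \<and> R (x', y) = 0" if "R (x, y) = 0" "x \<noteq> 0" for x y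
      using that R_scale [of "1 / norm x" x y] by (intro exI [where x = "(1 / norm x) *\<^sub>R x"]) simp
    then show ?thesis using frames by (fastforce simp: set_eq_iff)
  qed
  finally show ?thesis by (simp add: open_closed)
qed

lemma homotopic_loops_frames_linear:
  assumes "continuous_on {0..1} x" "continuous_on {0..1} y" "continuous_on {0..1} z"
    "continuous_on {0..1} x'" "continuous_on {0..1} y'" "continuous_on {0..1} z'"
    and "x 1 = x 0" "y 1 = y 0" "z 1 = z 0" "x' 1 = x' 0" "y' 1 = y' 0" "z' 1 = z' 0"
    and "\<And>t a b c. t \<in> {0..1} \<Longrightarrow> a \<in> closed_segment (x t) (x' t) \<Longrightarrow>
      b \<in> closed_segment (y t) (y' t) \<Longrightarrow> c \<in> closed_segment (z t) (z' t) \<Longrightarrow> (a, b, c) \<in> frames e"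
  shows "homotopic_loops (frames e) (\<lambda>t. (x t, y t, z t)) (\<lambda>t. (x' t, y' t, z' t))"
proof (rule homotopic_loops_linear)
  show "closed_segment (x t, y t, z t) (x' t, y' t, z' t) \<subseteq> frames e" if "t \<in> {0..1}" for t
  proof
    fix q assume q: "q \<in> closed_segment (x t, y t, z t) (x' t, y' t, z' t)"
    obtain a b c where abc: "q = (a, b, c)" by (cases q)
    show "q \<in> frames e"
      using closed_segment_PairD [OF q [unfolded abc]] closed_segment_PairD assms(13) that abc by blast
  qed
qed (use assms in \<open>auto simp: path_def pathstart_def pathfinish_def intro!: continuous_intros\<close>)

lemma loop_in_frames_differentiable:
  assumes "path p" "path_image p \<subseteq> frames e" "pathfinish p = pathstart p"
  obtains x y z where "x differentiable_on {0..1}" "y differentiable_on {0..1}" "z differentiable_on {0..1}"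
    "x 1 = x 0" "y 1 = y 0" "z 1 = z 0" "homotopic_loops (frames e) p (\<lambda>t. (x t, y t, z t))"
proof -
  obtain d where "d > 0" and d: "\<And>h. path h \<Longrightarrow> pathfinish h = pathstart h \<Longrightarrow>
      (\<forall>t\<in>{0..1}. norm (h t - p t) < d) \<Longrightarrow> homotopic_loops (frames e) p h"
    using homotopic_nearby_loops [OF assms(1) open_frames assms(2,3)] by blast
  obtain q where q: "polynomial_function q" "pathstart q = pathstart p" "pathfinish q = pathfinish p"
    "\<And>t. t \<in> {0..1} \<Longrightarrow> norm (q t - p t) < d"
    using path_approx_polynomial_function [OF assms(1) \<open>d > 0\<close>] by blast
  have end_eq: "q 1 = q 0" using q assms(3) by (simp add: pathstart_def pathfinish_def)
  have "homotopic_loops (frames e) p q"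
    using q assms(3) by (intro d path_polynomial_function) auto
  moreover have "(h \<circ> q) differentiable_on {0..1}" if "bounded_linear h" for h :: "_ \<Rightarrow> complex ^ 'a"
    using polynomial_function_compose [OF q(1) polynomial_function_bounded_linear [OF that]]
    by (rule differentiable_on_polynomial_function)
  ultimately show ?thesis
    using that [of "(\<lambda>v. fst v) \<circ> q" "(\<lambda>v. fst (snd v)) \<circ> q" "(\<lambda>v. snd (snd v)) \<circ> q"] end_eq
    by (simp add: bounded_linear_fst bounded_linear_snd bounded_linear_fst_comp bounded_linear_snd_comp)
qed

lemma segment_avoids_span:
  fixes x a :: "complex ^ 'n::finite"
  assumes "x \<notin> vec.span S" "a \<notin> vec.span (insert x S)" "u \<in> closed_segment x a"
  shows "u \<notin> vec.span S"
proof
  assume u: "u \<in> vec.span S"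
  obtain s where s: "u = (1 - s) *\<^sub>R x + s *\<^sub>R a"
    using assms(3) by (auto simp: closed_segment_def)
  show False
  proof (cases "s = 0")
    case True then show ?thesis using s u assms(1) by simp
  next
    case False
    then have "a = complex_of_real (1 / s) *s (u - complex_of_real (1 - s) *s x)"
      unfolding s scaleR_eq_smult by (simp add: vec_eq_iff)
    moreover have "complex_of_real (1 / s) *s (u - complex_of_real (1 - s) *s x) \<in> vec.span (insert x S)"
      using u vec.span_mono [of S "insert x S"] by (intro vec.span_scale vec.span_diff) (auto intro: vec.span_base)
    ultimately have "a \<in> vec.span (insert x S)" by simp
    then show ?thesis using assms(2) by blast
  qed
qed

text \<open>
  The entries are replaced by fixed vectors one after the other. Each new vector avoids the span of \<open>e\<close>
  and all three current entries, so the segment to it from the entry that it replaces avoids the span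
  of \<open>e\<close> and the other two.
\<close>

lemma loop_in_frames_null_homotopic:
  fixes e :: "complex ^ 'n::finite"
  assumes card: "CARD('n) > 4"
    and p: "path p" "path_image p \<subseteq> frames e" "pathfinish p = pathstart p"
  shows "\<exists>m. homotopic_loops (frames e) p (\<lambda>_. m)"
proof -
  obtain x y z where diff: "x differentiable_on {0..1}" "y differentiable_on {0..1}" "z differentiable_on {0..1}"
    and ends: "x 1 = x 0" "y 1 = y 0" "z 1 = z 0"
    and p_xyz: "homotopic_loops (frames e) p (\<lambda>t. (x t, y t, z t))"
    by (rule loop_in_frames_differentiable [OF p])
  note cont = diff [THEN differentiable_imp_continuous_on]
  obtain a where a: "\<And>t. t \<in> {0..1} \<Longrightarrow> a \<notin> vec.span {e, x t, y t, z t}"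
    using avoid_spans_of_4_curves [OF card differentiable_on_const [of e] diff] by blast
  obtain b where b: "\<And>t. t \<in> {0..1} \<Longrightarrow> b \<notin> vec.span {e, a, y t, z t}"
    using avoid_spans_of_4_curves [OF card differentiable_on_const [of e]
          differentiable_on_const [of a] diff(2,3)] by blast
  obtain c where c: "\<And>t. t \<in> {0..1} \<Longrightarrow> c \<notin> vec.span {e, a, b, z t}"
    using avoid_spans_of_4_curves [OF card differentiable_on_const [of e]
          differentiable_on_const [of a] differentiable_on_const [of b] diff(3)] by blast
  have xyz: "(x t, y t, z t) \<in> frames e" if "t \<in> {0..1}" for t
    using homotopic_loops_imp_subset [OF p_xyz] that by (auto simp: path_image_def)
  have ayz: "(u, y t, z t) \<in> frames e" if "t \<in> {0..1}" "u \<in> closed_segment (x t) a" for t u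
    using xyz [OF that(1)] a [OF that(1)] segment_avoids_span [OF _ _ that(2), of "{e, y t, z t}"]
    by (simp add: frames_first insert_commute)
  have abz: "(a, u, z t) \<in> frames e" if "t \<in> {0..1}" "u \<in> closed_segment (y t) b" for t u
    using ayz [OF that(1), of a] b [OF that(1)] segment_avoids_span [OF _ _ that(2), of "{e, a, z t}"]
    by (simp add: frames_second insert_commute)
  have abc: "(a, b, u) \<in> frames e" if "t \<in> {0..1}" "u \<in> closed_segment (z t) c" for t u
    using abz [OF that(1), of b] c [OF that(1)] segment_avoids_span [OF _ _ that(2), of "{e, a, b}"]
    by (simp add: frames_third insert_commute)
  have "homotopic_loops (frames e) (\<lambda>t. (x t, y t, z t)) (\<lambda>t. (a, y t, z t))"
    using ayz by (intro homotopic_loops_frames_linear) (auto simp: cont ends)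
  moreover have "homotopic_loops (frames e) (\<lambda>t. (a, y t, z t)) (\<lambda>t. (a, b, z t))"
    using abz by (intro homotopic_loops_frames_linear) (auto simp: cont ends)
  moreover have "homotopic_loops (frames e) (\<lambda>t. (a, b, z t)) (\<lambda>t. (a, b, c))"
    using abc by (intro homotopic_loops_frames_linear) (auto simp: cont ends)
  ultimately show ?thesis
    using p_xyz homotopic_loops_trans by blast
qed

section \<open>Loops of frames in dimension four\<close>

text \<open>
  The determinant of the vectors \<open>e, a, b, c\<close>, described by the properties that the homotopies use:
  homogeneity in the first two entries, invariance under adding multiples of the other vectors to them, and
  non-vanishing on independent vectors.
\<close>

locale frame_volume =
  fixes e :: "complex ^ 'n::finite"
    and vol :: "(complex ^ 'n) \<times> (complex ^ 'n) \<times> (complex ^ 'n) \<Rightarrow> complex"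
  assumes card: "CARD('n) = 4"
    and vol_continuous: "continuous_on UNIV vol"
    and vol_nonzero: "m \<in> frames e \<Longrightarrow> vol m \<noteq> 0"
    and vol_first: "r \<in> vec.span {e, b, c} \<Longrightarrow> vol (s *s a + r, b, c) = s * vol (a, b, c)"
    and vol_second: "r \<in> vec.span {e, a, c} \<Longrightarrow> vol (a, s *s b + r, c) = s * vol (a, b, c)"

text \<open>
  The rows of the matrix are \<open>e, a, b, c\<close>, placed at four indices that exhaust the index type.
\<close>

lemma exists_frame_volume:
  fixes e :: "complex ^ 'n::finite"
  assumes card: "CARD('n) = 4"
  shows "\<exists>vol. frame_volume e vol"
proof -
  obtain \<sigma> :: "'n \<Rightarrow> nat" where \<sigma>: "bij_betw \<sigma> UNIV {0..<4}"
    using ex_bij_betw_finite_nat [of "UNIV :: 'n set"] card by auto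
  have ex: "\<exists>i. \<sigma> i = k" if "k < 4" for k
  proof -
    have "k \<in> range \<sigma>" using bij_betw_imp_surj_on [OF \<sigma>] that by simp
    then show ?thesis by auto
  qed
  obtain i0 where "\<sigma> i0 = 0" using ex [of 0] by auto
  moreover obtain i1 where "\<sigma> i1 = 1" using ex [of 1] by auto
  moreover obtain i2 where "\<sigma> i2 = 2" using ex [of 2] by auto
  moreover obtain i3 where "\<sigma> i3 = 3" using ex [of 3] by auto
  ultimately
  have ne: "i0 \<noteq> i1" "i0 \<noteq> i2" "i0 \<noteq> i3" "i1 \<noteq> i2" "i1 \<noteq> i3" "i2 \<noteq> i3"
    by auto
  have UNIV: "UNIV = {i0, i1, i2, i3}"
  proof -
    have "card {i0, i1, i2, i3} = CARD('n)"
      using ne card by simp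
    then show ?thesis by (metis card_subset_eq finite subset_UNIV)
  qed
  define M where "M = (\<lambda>(a, b, c).
    (\<chi> i. if i = i1 then a else if i = i2 then b else if i = i3 then c else e) :: complex ^ 'n ^ 'n)"
  have row: "row i0 (M (a, b, c)) = e" "row i1 (M (a, b, c)) = a" "row i2 (M (a, b, c)) = b"
      "row i3 (M (a, b, c)) = c" for a b c
    using ne by (simp_all add: M_def row_def)
  have rows: "rows (M (a, b, c)) = {e, a, b, c}" for a b c
  proof -
    have "rows A = {row i0 A, row i1 A, row i2 A, row i3 A}" for A :: "complex ^ 'n ^ 'n"
      using UNIV by (auto simp: rows_def)
    then show ?thesis by (simp add: row)
  qed
  have zero_row: "det (\<chi> i. if i = k then r else row i A) = 0"
    if "r \<in> vec.span {row j A |j. j \<noteq> k}" for r k and A :: "complex ^ 'n ^ 'n"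
  proof -
    define A0 where "A0 = (\<chi> i. if i = k then 0 else row i A)"
    have A0: "row j A0 = (if j = k then 0 else row j A)" for j
      by (simp add: A0_def row_def)
    have "{row j A0 |j. j \<noteq> k} = {row j A |j. j \<noteq> k}"
      by (auto simp: A0)
    then have "det (\<chi> i. if i = k then row k A0 + r else row i A0) = det A0"
      using that by (intro det_row_span) simp
    moreover have "(\<chi> i. if i = k then row k A0 + r else row i A0) = (\<chi> i. if i = k then r else row i A)"
      by (simp add: A0 vec_eq_iff)
    moreover have "det A0 = 0"
      unfolding A0_def by (rule det_row_0)
    ultimately show ?thesis by simp
  qed
  have linear: "det (\<chi> i. if i = k then s *s row k A + r else row i A) = s * det A"
    if "r \<in> vec.span {row j A |j. j \<noteq> k}" for r s k and A :: "complex ^ 'n ^ 'n"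
  proof -
    have "(\<chi> i. if i = k then row k A else row i A) = A"
      by (simp add: vec_eq_iff row_def)
    then show ?thesis
      using det_row_add [of k "\<lambda>_. s *s row k A" "\<lambda>_. r" "\<lambda>i. row i A"]
        det_row_mul [of k s "\<lambda>_. row k A" "\<lambda>i. row i A"] zero_row [OF that] by simp
  qed
  have others: "{row j A |j. j \<noteq> i1} = {row i0 A, row i2 A, row i3 A}" (is ?first)
      "{row j A |j. j \<noteq> i2} = {row i0 A, row i1 A, row i3 A}" (is ?second) for A :: "complex ^ 'n ^ 'n"
  proof -
    have "{row j A |j. j \<noteq> k} = (\<lambda>j. row j A) ` ({i0, i1, i2, i3} - {k})" for k
      unfolding UNIV [symmetric] by auto
    then show ?first ?second using ne by (simp_all add: insert_Diff_if)
  qed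
  have "frame_volume e (\<lambda>m. det (M m))"
  proof
    show "CARD('n) = 4" by (fact card)
    show "continuous_on UNIV (\<lambda>m. det (M m))"
    proof -
      have "continuous_on UNIV (\<lambda>m. M m $ i $ j)" for i j
        unfolding M_def case_prod_unfold
        by (cases "i = i1"; cases "i = i2"; cases "i = i3") (auto intro!: continuous_intros)
      then show ?thesis
        unfolding det_def
        by (intro continuous_on_sum continuous_on_mult continuous_on_const continuous_on_prod)
    qed
    show "det (M m) \<noteq> 0" if "m \<in> frames e" for m
    proof -
      obtain a b c where m: "m = (a, b, c)" by (cases m)
      have "vec.dim (rows (M m)) = CARD('n)"
        using that card by (simp add: m rows frames_def)
      then have "vec.span (rows (M m)) = UNIV"
        by (rule span_eq_UNIV_of_dim)
      then show ?thesis
        using matrix_left_invertible_span_rows_gen [of "M m"] invertible_left_inverse [of "M m"]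
          invertible_det_nz [of "M m"] by simp
    qed
    show "det (M (s *s a + r, b, c)) = s * det (M (a, b, c))" if "r \<in> vec.span {e, b, c}" for r a b c s
    proof -
      have "M (s *s a + r, b, c) =
          (\<chi> i. if i = i1 then s *s row i1 (M (a, b, c)) + r else row i (M (a, b, c)))"
        using ne by (simp add: M_def vec_eq_iff row_def)
      then show ?thesis
        using linear [of r "M (a, b, c)" i1 s] that by (simp add: others row)
    qed
    show "det (M (a, s *s b + r, c)) = s * det (M (a, b, c))" if "r \<in> vec.span {e, a, c}" for r a b c s
    proof -
      have "M (a, s *s b + r, c) =
          (\<chi> i. if i = i2 then s *s row i2 (M (a, b, c)) + r else row i (M (a, b, c)))"
        using ne by (simp add: M_def vec_eq_iff row_def)
      then show ?thesis
        using linear [of r "M (a, b, c)" i2 s] that by (simp add: others row)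
    qed
  qed
  then show ?thesis by blast
qed

context frame_volume
begin

text \<open>
  Cramer's rule for the coefficients of \<open>a\<close> and \<open>b\<close> in the expansion of \<open>w\<close>. Its point is that these
  coefficients depend continuously on all the vectors.
\<close>

lemma cramer:
  assumes abc: "(a, b, c) \<in> frames e"
  shows "w - (vol (w, b, c) / vol (a, b, c)) *s a - (vol (a, w, c) / vol (a, b, c)) *s b \<in> vec.span {e, c}"
proof -
  have "vec.dim {a, b, e, c} = CARD('n)"
    using abc card by (simp add: frames_def insert_commute)
  then have "w \<in> vec.span {a, b, e, c}"
    by (simp add: span_eq_UNIV_of_dim)
  then obtain x y where r: "w - x *s a - y *s b \<in> vec.span {e, c}"
    unfolding vec.span_breakdown_eq [of w] vec.span_breakdown_eq [of _ b] by blast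
  define r where "r = w - x *s a - y *s b"
  have span: "y *s b + r \<in> vec.span {e, b, c}" "x *s a + r \<in> vec.span {e, a, c}"
    using r vec.span_mono [of "{e, c}" "{e, b, c}"] vec.span_mono [of "{e, c}" "{e, a, c}"]
    by (auto simp: r_def [symmetric] intro!: vec.span_add vec.span_scale intro: vec.span_base)
  have w: "w = x *s a + (y *s b + r)" "w = y *s b + (x *s a + r)"
    by (simp_all add: r_def)
  have "vol (w, b, c) = x * vol (a, b, c)"
    using vol_first [OF span(1), of x a] w(1) by simp
  moreover have "vol (a, w, c) = y * vol (a, b, c)"
    using vol_second [OF span(2), of y b] w(2) by simp
  ultimately show ?thesis
    using r vol_nonzero [OF abc] by simp
qed

lemma continuous_vol:
  assumes "continuous_on S x" "continuous_on S y" "continuous_on S z"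
  shows "continuous_on S (\<lambda>t. vol (x t, y t, z t))"
  by (rule continuous_on_compose2 [OF vol_continuous]) (intro continuous_on_Pair assms, simp)

text \<open>
  Write \<open>w = \<xi> x + \<eta> y + r\<close> with \<open>r\<close> in the span of \<open>e\<close> and \<open>z\<close>; the hypothesis on \<open>w\<close> says that \<open>\<xi>\<close> has
  no zero. With \<open>x' = x + ((\<eta> - 1) / \<xi>) y\<close> this reads \<open>w = \<xi> x' + y + r\<close>. Therefore \<open>x\<close> becomes \<open>x'\<close> by
  adding a multiple of \<open>y\<close>, and then \<open>y\<close> becomes \<open>w\<close> by adding an element of the span of \<open>e, x', z\<close>. Both
  changes can be made linearly in time without leaving the space of frames.
\<close>

lemma make_second_constant:
  assumes cont: "continuous_on {0..1} x" "continuous_on {0..1} y" "continuous_on {0..1} z"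
    and ends: "x 1 = x 0" "y 1 = y 0" "z 1 = z 0"
    and frame: "\<And>t. t \<in> {0..1} \<Longrightarrow> (x t, y t, z t) \<in> frames e"
    and w: "\<And>t. t \<in> {0..1} \<Longrightarrow> w \<notin> vec.span {e, y t, z t}"
  obtains x' where "continuous_on {0..1} x'" "x' 1 = x' 0"
    "homotopic_loops (frames e) (\<lambda>t. (x t, y t, z t)) (\<lambda>t. (x' t, w, z t))"
proof -
  define V where "V t = vol (x t, y t, z t)" for t
  define \<xi> where "\<xi> t = vol (w, y t, z t) / V t" for t
  define \<eta> where "\<eta> t = vol (x t, w, z t) / V t" for t
  define x' where "x' t = x t + ((\<eta> t - 1) / \<xi> t) *s y t" for t
  have V: "V t \<noteq> 0" and \<xi>: "\<xi> t \<noteq> 0" if "t \<in> {0..1}" for t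
  proof -
    show "V t \<noteq> 0" using vol_nonzero [OF frame [OF that]] by (simp add: V_def)
    moreover have "(w, y t, z t) \<in> frames e"
      using frame [OF that] w [OF that] by (simp add: frames_first)
    ultimately show "\<xi> t \<noteq> 0" using vol_nonzero by (simp add: \<xi>_def)
  qed
  have V_cont: "continuous_on {0..1} V"
    unfolding V_def by (intro continuous_vol cont)
  have \<xi>_cont: "continuous_on {0..1} \<xi>" and \<eta>_cont: "continuous_on {0..1} \<eta>"
    unfolding \<xi>_def \<eta>_def
    by (intro continuous_on_divide continuous_vol cont continuous_on_const V_cont ballI V; simp)+
  have x'_cont: "continuous_on {0..1} x'"
    unfolding x'_def using \<xi>
    by (intro continuous_on_add continuous_smult continuous_on_divide continuous_on_diff
        continuous_on_const cont \<xi>_cont \<eta>_cont) auto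
  have x'_ends: "x' 1 = x' 0"
    by (simp add: x'_def \<xi>_def \<eta>_def V_def ends)
  have remainder: "w - y t - \<xi> t *s x' t \<in> vec.span {e, z t}" if "t \<in> {0..1}" for t
  proof -
    have "w - y t - \<xi> t *s x' t = w - \<xi> t *s x t - \<eta> t *s y t"
      using \<xi> [OF that] by (simp add: x'_def vec_eq_iff field_simps)
    then show ?thesis
      using cramer [OF frame [OF that], of w] unfolding \<xi>_def \<eta>_def V_def by metis
  qed
  have first: "(u, y t, z t) \<in> frames e" if t: "t \<in> {0..1}" and u: "u \<in> closed_segment (x t) (x' t)" for t u
  proof -
    obtain s where "u = (1 - s) *\<^sub>R x t + s *\<^sub>R x' t"
      using u by (auto simp: closed_segment_def)
    then have "u = x t + (of_real s * ((\<eta> t - 1) / \<xi> t)) *s y t"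
      by (simp add: x'_def vec_eq_iff scaleR_conv_of_real [where 'a = complex] algebra_simps)
    then show ?thesis
      using frames_add_first [OF frame [OF t], of "(of_real s * ((\<eta> t - 1) / \<xi> t)) *s y t"]
      by (simp add: vec.span_scale vec.span_base)
  qed
  have second: "(x' t, u, z t) \<in> frames e" if t: "t \<in> {0..1}" and u: "u \<in> closed_segment (y t) w" for t u
  proof -
    obtain s where "u = (1 - s) *\<^sub>R y t + s *\<^sub>R w"
      using u by (auto simp: closed_segment_def)
    then have "u = y t + of_real s *s (w - y t)"
      by (simp add: vec_eq_iff scaleR_conv_of_real [where 'a = complex] algebra_simps)
    moreover have "w - y t \<in> vec.span {e, x' t, z t}"
    proof -
      have "w - y t - \<xi> t *s x' t \<in> vec.span {e, x' t, z t}"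
        using remainder [OF t] vec.span_mono [of "{e, z t}" "{e, x' t, z t}"] by blast
      then have "(w - y t - \<xi> t *s x' t) + \<xi> t *s x' t \<in> vec.span {e, x' t, z t}"
        by (intro vec.span_add vec.span_scale) (auto intro: vec.span_base)
      then show ?thesis by simp
    qed
    moreover have "(x' t, y t, z t) \<in> frames e" using first [OF t] by simp
    ultimately show ?thesis
      using frames_swap_first frames_add_first vec.span_scale by metis
  qed
  have "homotopic_loops (frames e) (\<lambda>t. (x t, y t, z t)) (\<lambda>t. (x' t, y t, z t))"
    using first by (intro homotopic_loops_frames_linear) (auto simp: cont ends x'_cont x'_ends)
  moreover have "homotopic_loops (frames e) (\<lambda>t. (x' t, y t, z t)) (\<lambda>t. (x' t, w, z t))"
    using second by (intro homotopic_loops_frames_linear) (auto simp: cont ends x'_cont x'_ends)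
  ultimately show ?thesis
    using that x'_cont x'_ends homotopic_loops_trans by blast
qed

text \<open>
  The second entry is made constant, then the third, by exchanging the two. Afterwards the
  first entry differs from a multiple of a fixed vector \<open>a\<close> by an element of the span of the fixed vectors
  \<open>e, b, c\<close>, which can be scaled to zero.
\<close>

lemma homotopic_to_scaled_frame:
  assumes p: "path p" "path_image p \<subseteq> frames e" "pathfinish p = pathstart p"
  obtains \<kappa> a b c where "continuous_on {0..1} \<kappa>" "\<kappa> 1 = \<kappa> 0" "(a, b, c) \<in> frames e"
    "homotopic_loops (frames e) p (\<lambda>t. (\<kappa> t *s a, b, c))"
proof -
  obtain x y z where diff: "x differentiable_on {0..1}" "y differentiable_on {0..1}" "z differentiable_on {0..1}"
    and ends: "x 1 = x 0" "y 1 = y 0" "z 1 = z 0"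
    and p_xyz: "homotopic_loops (frames e) p (\<lambda>t. (x t, y t, z t))"
    by (rule loop_in_frames_differentiable [OF p])
  note cont = diff [THEN differentiable_imp_continuous_on]
  have card': "CARD('n) > 3" by (simp add: card)
  obtain b where b: "\<And>t. t \<in> {0..1} \<Longrightarrow> b \<notin> vec.span {e, y t, z t}"
    using avoid_spans_of_3_curves [OF card' differentiable_on_const [of e] diff(2,3)] by blast
  obtain c where c: "\<And>t. t \<in> {0..1} \<Longrightarrow> c \<notin> vec.span {e, z t, b}"
    using avoid_spans_of_3_curves [OF card' differentiable_on_const [of e] diff(3)
          differentiable_on_const [of b]] by blast
  obtain a where a: "\<And>t::real. t \<in> {0..1} \<Longrightarrow> a \<notin> vec.span {e, b, c}"
    using avoid_spans_of_3_curves [OF card' differentiable_on_const [of e] differentiable_on_const [of b]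
          differentiable_on_const [of c]] by blast
  have "(x t, y t, z t) \<in> frames e" if "t \<in> {0..1}" for t
    using homotopic_loops_imp_subset [OF p_xyz] that by (auto simp: path_image_def)
  then obtain x1 where x1: "continuous_on {0..1} x1" "x1 1 = x1 0"
    and h1: "homotopic_loops (frames e) (\<lambda>t. (x t, y t, z t)) (\<lambda>t. (x1 t, b, z t))"
    using make_second_constant [OF cont ends _ b] by blast
  have f1: "(x1 t, z t, b) \<in> frames e" if "t \<in> {0..1}" for t
    using homotopic_loops_imp_subset [OF h1] that by (subst frames_swap) (auto simp: path_image_def)
  obtain x2 where x2: "continuous_on {0..1} x2" "x2 1 = x2 0"
    and h2': "homotopic_loops (frames e) (\<lambda>t. (x1 t, z t, b)) (\<lambda>t. (x2 t, c, b))"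
    using make_second_constant [OF x1(1) cont(3) continuous_on_const x1(2) ends(3) refl f1 c] by blast
  have "homotopic_loops (frames e) ((\<lambda>(a, b, c). (a, c, b)) \<circ> (\<lambda>t. (x1 t, z t, b)))
      ((\<lambda>(a, b, c). (a, c, b)) \<circ> (\<lambda>t. (x2 t, c, b)))"
    by (rule homotopic_loops_continuous_image [OF h2'])
      (auto simp: case_prod_unfold frames_swap intro!: continuous_intros)
  then have h2: "homotopic_loops (frames e) (\<lambda>t. (x1 t, b, z t)) (\<lambda>t. (x2 t, b, c))"
    by (simp add: o_def)
  have f2: "(x2 t, b, c) \<in> frames e" if "t \<in> {0..1}" for t
    using homotopic_loops_imp_subset [OF h2] that by (auto simp: path_image_def)
  have abc: "(a, b, c) \<in> frames e"
    using f2 [of 0] a [of 0] by (simp add: frames_first)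
  define \<kappa> where "\<kappa> t = vol (x2 t, b, c) / vol (a, b, c)" for t
  have \<kappa>: "continuous_on {0..1} \<kappa>" "\<kappa> 1 = \<kappa> 0"
  proof -
    show "continuous_on {0..1} \<kappa>"
      unfolding \<kappa>_def using x2 vol_nonzero [OF abc]
      by (intro continuous_on_divide continuous_vol continuous_on_const) auto
    show "\<kappa> 1 = \<kappa> 0" by (simp add: \<kappa>_def x2)
  qed
  have remainder: "x2 t - \<kappa> t *s a \<in> vec.span {e, b, c}" if "t \<in> {0..1}" for t
  proof -
    let ?r = "x2 t - \<kappa> t *s a - (vol (a, x2 t, c) / vol (a, b, c)) *s b"
    have "?r + (vol (a, x2 t, c) / vol (a, b, c)) *s b \<in> vec.span {e, b, c}"
      using cramer [OF abc, of "x2 t"] vec.span_mono [of "{e, c}" "{e, b, c}"]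
      by (intro vec.span_add vec.span_scale) (auto simp: \<kappa>_def intro: vec.span_base)
    then show ?thesis by simp
  qed
  have "(u, b, c) \<in> frames e" if t: "t \<in> {0..1}" and u: "u \<in> closed_segment (x2 t) (\<kappa> t *s a)" for t u
  proof -
    obtain s where "u = (1 - s) *\<^sub>R x2 t + s *\<^sub>R (\<kappa> t *s a)"
      using u by (auto simp: closed_segment_def)
    then have "u = x2 t + (- of_real s) *s (x2 t - \<kappa> t *s a)"
      by (simp add: vec_eq_iff scaleR_conv_of_real [where 'a = complex] algebra_simps)
    then show ?thesis
      using frames_add_first [OF f2 [OF t] vec.span_scale [OF remainder [OF t]]] by metis
  qed
  then have "homotopic_loops (frames e) (\<lambda>t. (x2 t, b, c)) (\<lambda>t. (\<kappa> t *s a, b, c))"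
    by (intro homotopic_loops_frames_linear) (auto simp: x2 \<kappa> intro!: continuous_smult continuous_intros)
  then show ?thesis
    using that \<kappa> abc p_xyz h1 h2 homotopic_loops_trans by blast
qed

text \<open>
  The map \<open>s\<close> from the punctured plane to the frames is a section of \<open>vol\<close> that takes the loop of volumes of
  \<open>(\<kappa> a, b, c)\<close> back to that loop. So it carries a contraction of the loop of volumes to a contraction of
  the loop of frames.
\<close>

lemma null_homotopic_if_winding_zero:
  assumes p: "path p" "path_image p \<subseteq> frames e" "pathfinish p = pathstart p"
    and winding: "winding_number (vol \<circ> p) 0 = 0"
  shows "\<exists>m. homotopic_loops (frames e) p (\<lambda>_. m)"
proof -
  obtain \<kappa> a b c where \<kappa>: "continuous_on {0..1} \<kappa>" "\<kappa> 1 = \<kappa> 0" and abc: "(a, b, c) \<in> frames e"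
    and h: "homotopic_loops (frames e) p (\<lambda>t. (\<kappa> t *s a, b, c))"
    by (rule homotopic_to_scaled_frame [OF p])
  define q where "q = (\<lambda>t. (\<kappa> t *s a, b, c))"
  have vol_scaled: "vol (k *s a, b, c) = k * vol (a, b, c)" for k
    using vol_first [of 0 b c k a] by (simp add: vec.span_zero)
  have vol_abc: "vol (a, b, c) \<noteq> 0" using abc vol_nonzero by blast
  have vol_h: "homotopic_loops (- {0}) (vol \<circ> p) (vol \<circ> q)"
  proof (rule homotopic_loops_continuous_image)
    show "homotopic_loops (frames e) p q" using h by (simp add: q_def)
    show "continuous_on (frames e) vol" by (rule continuous_on_subset [OF vol_continuous subset_UNIV])
    show "vol \<in> frames e \<rightarrow> - {0}" using vol_nonzero by auto
  qed
  have "winding_number (vol \<circ> q) 0 = 0"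
    using winding winding_number_homotopic_loops [OF vol_h] by simp
  moreover have "path (vol \<circ> q)" "0 \<notin> path_image (vol \<circ> q)"
    using homotopic_loops_imp_path [OF vol_h] homotopic_loops_imp_subset [OF vol_h] by auto
  ultimately obtain l where l: "homotopic_loops (- {0}) (vol \<circ> q) (\<lambda>_. l)"
    using winding_number_homotopic_loops_null_eq by blast
  define s where "s k = ((k / vol (a, b, c)) *s a, b, c)" for k
  have "s \<in> - {0} \<rightarrow> frames e"
  proof
    fix k :: complex assume "k \<in> - {0}"
    then have k: "k / vol (a, b, c) \<noteq> 0" using vol_abc by simp
    then show "s k \<in> frames e" unfolding s_def by (rule frames_scale_first [OF abc])
  qed
  moreover have "continuous_on (- {0}) s"
    unfolding s_def using vol_abc by (intro continuous_intros continuous_smult) auto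
  ultimately have "homotopic_loops (frames e) (s \<circ> (vol \<circ> q)) (s \<circ> (\<lambda>_. l))"
    using homotopic_loops_continuous_image [OF l] by blast
  moreover have "s \<circ> (vol \<circ> q) = q"
    using vol_abc by (simp add: fun_eq_iff s_def q_def vol_scaled)
  ultimately have "homotopic_loops (frames e) q (\<lambda>_. s l)"
    by (simp add: o_def)
  then show ?thesis
    using homotopic_loops_trans [OF h [folded q_def]] by blast
qed

end

section \<open>Points of projective space and normalised pairs\<close>

lemma vline_cproj_point:
  fixes v :: "complex ^ 'n::finite"
  assumes "v \<noteq> 0"
  shows "vline (cproj_point v) = vec.span {v}"
  unfolding cproj_point_def using assms by (intro Abs_cproj_inverse) simp

lemma cproj_point_exhaust:
  obtains v where "v \<noteq> 0" "X = cproj_point v"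
proof -
  have X: "vec.subspace (vline X)" "vec.dim (vline X) = 1"
    using vline [of X] by auto
  obtain B where B: "B \<subseteq> vline X" "vec.independent B" "vline X \<subseteq> vec.span B" "card B = 1"
    using vec.basis_exists [of "vline X"] X(2) by metis
  then obtain v where v: "B = {v}" by (auto simp: card_1_singleton_iff)
  have "vline X = vec.span {v}"
    using B v X(1) vec.span_minimal by blast
  moreover have "v \<noteq> 0" using B v vec.dependent_zero by auto
  ultimately show ?thesis
    using that vline_cproj_point vline_inject by metis
qed

lemma cproj_point_eq_iff:
  assumes "u \<noteq> 0" "v \<noteq> 0"
  shows "cproj_point u = cproj_point v \<longleftrightarrow> (\<exists>k. k \<noteq> 0 \<and> u = k *s v)"
proof
  assume "cproj_point u = cproj_point v"
  then have "u \<in> vec.span {v}"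
    using vline_cproj_point assms by (metis insertI1 vec.span_base)
  then show "\<exists>k. k \<noteq> 0 \<and> u = k *s v"
    using assms by (auto simp: vec.span_singleton)
next
  assume "\<exists>k. k \<noteq> 0 \<and> u = k *s v"
  then obtain k where k: "k \<noteq> 0" "u = k *s v" by blast
  have "vec.span {u} = vec.span {v}"
  proof -
    have "(\<Union>r. {r *s v}) = (\<Union>r. {r *s (k *s v)})"
    proof -
      have "r *s v = (r / k) *s (k *s v)" for r using k by simp
      moreover have "r *s (k *s v) = (r * k) *s v" for r by simp
      ultimately show ?thesis by blast
    qed
    then show ?thesis by (auto simp: vec.span_singleton k)
  qed
  then show "cproj_point u = cproj_point v" by (simp add: cproj_point_def)
qed

lemma cproj_point_scale: "u \<noteq> 0 \<Longrightarrow> k \<noteq> 0 \<Longrightarrow> cproj_point (k *s u) = cproj_point u"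
  by (subst cproj_point_eq_iff) auto

lemma continuous_cproj_point: "continuous_on (- {0 :: complex ^ 'n::finite}) cproj_point"
proof -
  have "cproj_point -` B \<inter> - {0} = {v. v \<noteq> 0 \<and> cproj_point v \<in> B}" for B :: "'n::finite cproj set"
    by auto
  then show ?thesis
    by (simp add: continuous_on_open_vimage open_Compl open_cproj_def)
qed

text \<open>
  The preimage of the image of \<open>U\<close> is the union of all multiples of \<open>U\<close> by nonzero scalars.
\<close>

lemma open_cproj_point_image:
  fixes U :: "(complex ^ 'n::finite) set"
  assumes "open U" "0 \<notin> U"
  shows "open (cproj_point ` U)"
proof -
  have "{v. v \<noteq> 0 \<and> cproj_point v \<in> cproj_point ` U} = (\<Union>k\<in>- {0}. (\<lambda>v. k *s v) -` U)"
  proof -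
    have "(v \<noteq> 0 \<and> cproj_point v \<in> cproj_point ` U) = (\<exists>k. k \<noteq> 0 \<and> k *s v \<in> U)" for v
    proof (cases "v = 0")
      case True
      then show ?thesis using assms(2) by auto
    next
      case False
      have "cproj_point u = cproj_point v \<longleftrightarrow> (\<exists>k. k \<noteq> 0 \<and> u = k *s v)" if "u \<in> U" for u
        using that False assms(2) by (intro cproj_point_eq_iff) auto
      then show ?thesis using False by (auto simp: image_iff) metis+
    qed
    then show ?thesis by (simp add: set_eq_iff Bex_def)
  qed
  moreover have "open ((\<lambda>v. k *s v) -` U)" for k
    using assms(1) by (intro open_vimage continuous_smult continuous_intros)
  ultimately show ?thesis unfolding open_cproj_def by auto
qed

lemma proj_cone_points:
  assumes "\<And>v. v \<in> V \<Longrightarrow> v \<noteq> 0"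
  shows "vec.span (proj_cone (cproj_point ` V)) = vec.span V"
proof -
  have cone: "proj_cone (cproj_point ` V) = (\<Union>v\<in>V. vec.span {v})"
    using assms by (auto simp: proj_cone_def vline_cproj_point)
  have "V \<subseteq> (\<Union>v\<in>V. vec.span {v})"
    by (auto intro: vec.span_base)
  moreover have "(\<Union>v\<in>V. vec.span {v}) \<subseteq> vec.span V"
    by (intro UN_least vec.span_mono) auto
  ultimately show ?thesis
    unfolding cone by (metis vec.span_mono vec.span_span subset_antisym)
qed

lemma cproj_point_in_proj_span_iff:
  assumes "\<And>v. v \<in> V \<Longrightarrow> v \<noteq> 0" "u \<noteq> 0"
  shows "cproj_point u \<in> proj_span (cproj_point ` V) \<longleftrightarrow> u \<in> vec.span V"
proof -
  have "vec.span {u} \<subseteq> vec.span V \<longleftrightarrow> u \<in> vec.span V"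
    by (metis insert_subset empty_subsetI vec.span_base vec.span_minimal vec.subspace_span insertI1 subsetD)
  then show ?thesis
    by (simp add: proj_span_def vline_cproj_point assms proj_cone_points)
qed

lemma proj_dim_proj_span:
  assumes "\<And>v. v \<in> V \<Longrightarrow> v \<noteq> 0"
  shows "proj_dim (proj_span (cproj_point ` V)) = int (vec.dim V) - 1"
proof -
  define L where "L = proj_span (cproj_point ` V)"
  have L: "X \<in> L \<longleftrightarrow> vline X \<subseteq> vec.span V" for X
    by (simp add: L_def proj_span_def proj_cone_points assms)
  have "vec.span (proj_cone L) = vec.span V"
  proof
    have "proj_cone L \<subseteq> vec.span V"
      unfolding proj_cone_def using L by blast
    then show "vec.span (proj_cone L) \<subseteq> vec.span V"
      by (simp add: vec.span_minimal)
    have "v \<in> proj_cone L" if v: "v \<in> V" for v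
    proof -
      have "vline (cproj_point v) = vec.span {v}"
        using assms v by (simp add: vline_cproj_point)
      then have "cproj_point v \<in> L" "v \<in> vline (cproj_point v)"
        using v by (auto simp: L vec.span_base intro: vec.span_mono [THEN subsetD])
      then show ?thesis unfolding proj_cone_def by blast
    qed
    then show "vec.span V \<subseteq> vec.span (proj_cone L)"
      by (intro vec.span_mono) auto
  qed
  then show ?thesis unfolding proj_dim_def L_def [symmetric] by (metis vec.dim_span)
qed

lemma cproj_point_in_proj_line_iff:
  assumes "u \<noteq> 0" "v \<noteq> 0" "w \<noteq> 0"
  shows "cproj_point w \<in> proj_line (cproj_point u) (cproj_point v) \<longleftrightarrow> w \<in> vec.span {u, v}"
  using cproj_point_in_proj_span_iff [of "{u, v}" w] assms by (auto simp: proj_line_def)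

definition pair_of :: "complex ^ 'n \<Rightarrow> complex ^ 'n \<Rightarrow> 'n::finite cproj \<times> 'n cproj" where
  "pair_of e a = (cproj_point a, cproj_point (a + e))"

lemma not_in_span_singleton:
  assumes "a \<notin> vec.span {e :: complex ^ 'n::finite}"
  shows "a \<noteq> 0" "a + e \<noteq> 0"
proof -
  show "a \<noteq> 0" using assms vec.span_zero by auto
  show "a + e \<noteq> 0"
  proof
    assume "a + e = 0"
    then have "a = - e" by (simp add: eq_neg_iff_add_eq_0)
    then show False using assms vec.span_neg [OF vec.span_base [of e "{e}"]] by simp
  qed
qed

lemma combination_zero:
  assumes "a \<notin> vec.span {e :: complex ^ 'n::finite}" "e \<noteq> 0" "k *s a = l *s e"
  shows "k = 0" "l = 0"
proof -
  show "k = 0"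
  proof (rule ccontr)
    assume "k \<noteq> 0"
    then have "a = (1 / k) *s (k *s a)" by simp
    then have "a = (l / k) *s e" unfolding assms(3) by simp
    then show False using assms(1) by (auto simp: vec.span_singleton)
  qed
  then show "l = 0" using assms by simp
qed

lemma pair_of_inj:
  assumes e: "e \<noteq> 0" and a: "a \<notin> vec.span {e}" and b: "b \<notin> vec.span {e :: complex ^ 'n::finite}"
    and eq: "pair_of e a = pair_of e b"
  shows "a = b"
proof -
  obtain k where k: "b = k *s a"
    using eq not_in_span_singleton [OF a] not_in_span_singleton [OF b] cproj_point_eq_iff [of b a]
    by (auto simp: pair_of_def)
  obtain l where l: "b + e = l *s (a + e)"
    using eq not_in_span_singleton [OF a] not_in_span_singleton [OF b] cproj_point_eq_iff [of "b + e" "a + e"]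
    by (auto simp: pair_of_def)
  have "(k - l) *s a = (l - 1) *s e"
    using l unfolding k by (simp add: vec_eq_iff algebra_simps)
  then have "k = 1"
    using combination_zero [OF a e] by (metis eq_iff_diff_eq_0)
  then show ?thesis using k by simp
qed

text \<open>
  If \<open>e = k u + l v\<close> for representatives \<open>u\<close> of \<open>A\<close> and \<open>v\<close> of \<open>B\<close>, then both coefficients are nonzero since
  \<open>A\<close> and \<open>B\<close> differ from the class of \<open>e\<close>. The vector \<open>a = - k u\<close> represents \<open>A\<close>, and \<open>a + e = l v\<close>
  represents \<open>B\<close>.
\<close>

lemma exists_normalised_pair:
  assumes e: "e \<noteq> 0" and ne: "A \<noteq> B" "A \<noteq> cproj_point e" "B \<noteq> cproj_point e"
    and line: "cproj_point e \<in> proj_line A B"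
  obtains a where "a \<notin> vec.span {e}" "(A, B) = pair_of e a"
proof -
  obtain u v where uv: "u \<noteq> 0" "A = cproj_point u" "v \<noteq> 0" "B = cproj_point v"
    by (metis cproj_point_exhaust)
  have "e \<in> vec.span {u, v}"
    using line uv e cproj_point_in_proj_line_iff by blast
  then obtain k l where "e = k *s u + l *s v"
    by (auto simp: vec.span_breakdown_eq vec.span_singleton algebra_simps)
  then have e_uv: "l *s v = e - k *s u" "k *s u = e - l *s v" by simp_all
  have l: "l \<noteq> 0"
    using e_uv(1) ne(2) e uv cproj_point_scale [of u k] by (metis diff_eq_eq add_0 vec.scale_zero_left right_minus_eq)
  have k: "k \<noteq> 0"
    using e_uv(2) ne(3) e uv cproj_point_scale [of v l] by (metis diff_eq_eq add_0 vec.scale_zero_left right_minus_eq)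
  define a where "a = (- k) *s u"
  have a: "cproj_point a = A"
    unfolding a_def uv using k uv by (intro cproj_point_scale) auto
  have "a + e = l *s v" by (simp add: a_def e_uv(1))
  then have b: "cproj_point (a + e) = B"
    using uv l cproj_point_scale by metis
  have "a \<notin> vec.span {e}"
  proof
    assume "a \<in> vec.span {e}"
    then obtain r where r: "a = r *s e" by (auto simp: vec.span_singleton)
    have "a \<noteq> 0" using k uv by (simp add: a_def)
    then have "r \<noteq> 0" using r by auto
    then show False using r a ne(2) e cproj_point_scale by metis
  qed
  then show ?thesis using that a b by (simp add: pair_of_def)
qed

definition normalise :: "complex ^ 'n \<Rightarrow> 'n::finite cproj \<times> 'n cproj \<Rightarrow> complex ^ 'n" where
  "normalise e P = (SOME a. a \<notin> vec.span {e} \<and> P = pair_of e a)"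

lemma normalise_pair_of:
  assumes "e \<noteq> 0" "a \<notin> vec.span {e}"
  shows "normalise e (pair_of e a) = a"
proof -
  have "normalise e (pair_of e a) \<notin> vec.span {e} \<and> pair_of e a = pair_of e (normalise e (pair_of e a))"
    unfolding normalise_def by (rule someI [of _ a]) (simp add: assms)
  then show ?thesis using pair_of_inj assms by metis
qed

text \<open>
  For representatives \<open>x, y\<close> of the two points, Cramer's rule with a suitable minor expresses the
  normalised vector as a continuous function \<open>h (x, y)\<close> near \<open>(a, a + e)\<close>. Since the projection from nonzero
  vectors to points is open, neighbourhoods of the representatives give neighbourhoods of the points.
\<close>

lemma continuous_normalise:
  fixes e :: "complex ^ 'n::finite"
  assumes e: "e \<noteq> 0"
  shows "continuous_on (pair_of e ` (- vec.span {e})) (normalise e)"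
  unfolding continuous_on_topological
proof (intro ballI allI impI)
  fix P and U :: "(complex ^ 'n) set"
  assume "P \<in> pair_of e ` (- vec.span {e})" and "open U" and "normalise e P \<in> U"
  then obtain a where a: "a \<notin> vec.span {e}" "P = pair_of e a" and aU: "a \<in> U"
    using normalise_pair_of [OF e] by auto
  \<comment> \<open>The minors of the matrix with columns x and y; one is nonzero as a and e are independent.\<close>
  define m where "m i j = (\<lambda>(x :: complex ^ 'n, y :: complex ^ 'n). x $ i * y $ j - x $ j * y $ i)" for i j
  have m_cont: "continuous_on UNIV (m i j)" for i j
    unfolding m_def case_prod_unfold by (intro continuous_intros)
  have "\<exists>i j. m i j (a, e) \<noteq> 0"
  proof (rule ccontr)
    assume "\<not> ?thesis"
    then have m0: "a $ i * e $ j = a $ j * e $ i" for i j by (simp add: m_def)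
    obtain j where "e $ j \<noteq> 0" using e by (auto simp: vec_eq_iff)
    then have "a = (a $ j / e $ j) *s e" using m0 [of _ j] by (simp add: vec_eq_iff field_simps)
    then show False using a(1) by (auto simp: vec.span_singleton)
  qed
  then obtain i j where "m i j (a, e) \<noteq> 0" by blast
  moreover have "m i j (a, a + e) = m i j (a, e)" by (simp add: m_def algebra_simps)
  ultimately have ij: "m i j (a, a + e) \<noteq> 0" by simp
  define h where "h = (\<lambda>(x, y). (- (m i j (e, y) / m i j (x, y))) *s x)"
  let ?N = "{q. m i j q \<noteq> 0}"
  have "open ?N" using m_cont by (intro open_Collect_neq) auto
  have h_cont: "continuous_on ?N h"
  proof -
    have "continuous_on ?N (\<lambda>q. m i j (e, snd q))"
      by (rule continuous_on_compose2 [OF m_cont]) (auto intro!: continuous_intros)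
    then show ?thesis
      unfolding h_def case_prod_unfold
      by (intro continuous_smult continuous_intros) (auto intro: continuous_on_subset [OF m_cont])
  qed
  have h_eq: "b = h (x, y)" if "m i j (x, y) \<noteq> 0" "b = k *s x" "b + e = l *s y" for x y b k l
  proof -
    have e_xy: "e = l *s y - k *s x" using that by (simp add: algebra_simps)
    have "m i j (e, y) = - k * m i j (x, y)"
      unfolding m_def e_xy by (simp add: algebra_simps)
    then show ?thesis using that by (simp add: h_def)
  qed
  have "open (h -` U \<inter> ?N)"
    using h_cont \<open>open U\<close> \<open>open ?N\<close> by (simp add: continuous_on_open_vimage)
  moreover have "(a, a + e) \<in> h -` U \<inter> ?N"
    using h_eq [OF ij, of a 1 1] ij aU by simp
  ultimately obtain X Y where XY: "open X" "open Y" "a \<in> X" "a + e \<in> Y" "X \<times> Y \<subseteq> h -` U \<inter> ?N"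
    by (rule open_prod_elim) auto
  let ?T = "(cproj_point ` (X - {0})) \<times> (cproj_point ` (Y - {0}))"
  have "open ?T"
    using XY by (intro open_Times open_cproj_point_image open_Diff) auto
  moreover have "P \<in> ?T"
    using XY not_in_span_singleton [OF a(1)] by (auto simp: a(2) pair_of_def)
  moreover have "normalise e Q \<in> U" if Q: "Q \<in> pair_of e ` (- vec.span {e})" "Q \<in> ?T" for Q
  proof -
    obtain b where b: "b \<notin> vec.span {e}" "Q = pair_of e b" using Q by auto
    obtain x y where xy: "x \<in> X" "x \<noteq> 0" "cproj_point b = cproj_point x"
      "y \<in> Y" "y \<noteq> 0" "cproj_point (b + e) = cproj_point y"
      using Q(2) b(2) by (auto simp: pair_of_def)
    obtain k l where "b = k *s x" "b + e = l *s y"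
      using xy not_in_span_singleton [OF b(1)] cproj_point_eq_iff by metis
    moreover have xyN: "(x, y) \<in> h -` U \<inter> ?N" using XY(5) xy by blast
    ultimately have "b = h (x, y)" by (intro h_eq) auto
    then show ?thesis using xyN b normalise_pair_of [OF e b(1)] by simp
  qed
  ultimately show "\<exists>T. open T \<and> P \<in> T \<and> (\<forall>Q\<in>pair_of e ` (- vec.span {e}). Q \<in> T \<longrightarrow> normalise e Q \<in> U)"
    by blast
qed

section \<open>Configurations as frames\<close>

definition configuration :: "complex ^ 'n \<Rightarrow>
    (complex ^ 'n) \<times> (complex ^ 'n) \<times> (complex ^ 'n) \<Rightarrow> 'n::finite six_points" where
  "configuration e = (\<lambda>(a, b, c). (cproj_point a, cproj_point (a + e),
     cproj_point b, cproj_point (b + e), cproj_point c, cproj_point (c + e)))"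

definition directions :: "complex ^ 'n \<Rightarrow> 'n::finite six_points \<Rightarrow>
    (complex ^ 'n) \<times> (complex ^ 'n) \<times> (complex ^ 'n)" where
  "directions e = (\<lambda>(A1, B1, A2, B2, A3, B3).
     (normalise e (A1, B1), normalise e (A2, B2), normalise e (A3, B3)))"

lemma frames_not_in_span:
  assumes "(a, b, c) \<in> frames e"
  shows "a \<notin> vec.span {e}" "b \<notin> vec.span {e}" "c \<notin> vec.span {e}"
  using assms vec.span_mono [of "{e}" "{e, _, _}"]
  by (auto simp: frames_first, auto simp: frames_second [of a b c], auto simp: frames_third [of a b c])

lemma span_configuration:
  "vec.span {a, a + e, b, b + e, c, c + e} = vec.span {e, a, b, c :: complex ^ 'n::finite}"
proof -
  let ?S = "{a, a + e, b, b + e, c, c + e}" and ?T = "{e, a, b, c}"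
  have "?S \<subseteq> vec.span ?T"
    by (auto intro!: vec.span_add intro: vec.span_base)
  moreover have "(a + e) - a \<in> vec.span ?S"
    by (intro vec.span_diff) (auto intro: vec.span_base)
  then have "?T \<subseteq> vec.span ?S"
    by (auto intro: vec.span_base)
  ultimately show ?thesis by (simp add: vec.span_eq)
qed

lemma span_pair: "vec.span {a, a + e} = vec.span {e, a :: complex ^ 'n::finite}"
  using span_configuration [of a e a a] by (simp add: insert_commute)

lemma desargues3_at_iff:
  "(A1, B1, A2, B2, A3, B3) \<in> desargues3_at I \<longleftrightarrow>
    distinct [I, A1, B1, A2, B2, A3, B3] \<and>
    proj_line A1 B1 \<inter> proj_line A2 B2 \<inter> proj_line A3 B3 = {I} \<and>
    {A1, B1} \<subseteq> proj_line A1 B1 \<and> {A2, B2} \<subseteq> proj_line A2 B2 \<and> {A3, B3} \<subseteq> proj_line A3 B3 \<and>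
    proj_dim (proj_span {A1, B1, A2, B2, A3, B3}) = 3"
proof (cases "proj_line A1 B1 \<inter> proj_line A2 B2 \<inter> proj_line A3 B3 = {I}")
  case True
  then show ?thesis
    unfolding desargues3_at_def desargues3_def Let_def mem_Collect_eq prod.case True
    by (simp only: is_singletonI insert_subset empty_subsetI Diff_iff distinct.simps list.set) auto
qed (simp add: desargues3_at_def)

text \<open>
  All incidences are read off from coordinates with respect to the independent vectors \<open>e, a, b, c\<close>.
  In particular two points coincide exactly if their coordinates are proportional.
\<close>

lemma configuration_in_desargues3_at:
  assumes frame: "m \<in> frames e"
  shows "configuration e m \<in> desargues3_at (cproj_point e)"
proof -
  obtain a b c where abc: "m = (a, b, c)" by (cases m)
  define v where "v k l m n = k *s e + l *s a + m *s b + n *s c" for k l m n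
  have v_eq: "v k l m n = v k' l' m' n' \<longleftrightarrow> (k, l, m, n) = (k', l', m', n')" for k l m n k' l' m' n'
  proof
    assume "v k l m n = v k' l' m' n'"
    then have "(k - k') *s e + (l - l') *s a + (m - m') *s b + (n - n') *s c = 0"
      unfolding v_def by (simp add: algebra_simps)
    then have "(k - k', l - l', m - m', n - n') = 0"
      using frame unfolding abc frames_iff_no_relation by blast
    then show "(k, l, m, n) = (k', l', m', n')" by (simp add: zero_prod_def)
  qed simp
  have v_zero: "v k l m n = 0 \<longleftrightarrow> (k, l, m, n) = (0, 0, 0, 0)" for k l m n
    using v_eq [of k l m n 0 0 0 0] by (simp add: v_def)
  have v_scale: "r *s v k l m n = v (r * k) (r * l) (r * m) (r * n)" for r k l m n
    by (simp add: v_def vec.scale_right_distrib)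
  have P_eq: "cproj_point (v k l m n) = cproj_point (v k' l' m' n') \<longleftrightarrow>
      (\<exists>r. r \<noteq> 0 \<and> k = r * k' \<and> l = r * l' \<and> m = r * m' \<and> n = r * n')"
    if "(k, l, m, n) \<noteq> (0, 0, 0, 0)" "(k', l', m', n') \<noteq> (0, 0, 0, 0)" for k l m n k' l' m' n'
    using that by (subst cproj_point_eq_iff) (auto simp: v_zero v_scale v_eq)
  have vs: "e = v 1 0 0 0" "a = v 0 1 0 0" "a + e = v 1 1 0 0" "b = v 0 0 1 0" "b + e = v 1 0 1 0"
    "c = v 0 0 0 1" "c + e = v 1 0 0 1"
    by (simp_all add: v_def)
  let ?P = "\<lambda>k l m n. cproj_point (v k l m n)"
  have distinct: "distinct [?P 1 0 0 0, ?P 0 1 0 0, ?P 1 1 0 0, ?P 0 0 1 0, ?P 1 0 1 0, ?P 0 0 0 1, ?P 1 0 0 1]"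
    by (simp add: P_eq)
  have ne: "e \<noteq> 0" "a \<noteq> 0" "a + e \<noteq> 0" "b \<noteq> 0" "b + e \<noteq> 0" "c \<noteq> 0" "c + e \<noteq> 0"
    using v_zero [of 1 0 0 0] frames_not_in_span [OF frame [unfolded abc], THEN not_in_span_singleton(1)]
      frames_not_in_span [OF frame [unfolded abc], THEN not_in_span_singleton(2)]
    by (simp_all add: v_def)
  have line: "cproj_point x \<in> proj_line (cproj_point u) (cproj_point (u + e)) \<longleftrightarrow> x \<in> vec.span {e, u}"
    if "x \<noteq> 0" "u \<noteq> 0" "u + e \<noteq> 0" for x u
    using that by (simp add: cproj_point_in_proj_line_iff span_pair)
  let ?d = "\<lambda>u. proj_line (cproj_point u) (cproj_point (u + e))"
  have meet: "?d a \<inter> ?d b \<inter> ?d c = {cproj_point e}"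
  proof
    have "cproj_point e \<in> ?d u" if "u \<noteq> 0" "u + e \<noteq> 0" for u
      using that ne by (simp add: line vec.span_base)
    then show "{cproj_point e} \<subseteq> ?d a \<inter> ?d b \<inter> ?d c" using ne by simp
    show "?d a \<inter> ?d b \<inter> ?d c \<subseteq> {cproj_point e}"
    proof
      fix X assume X: "X \<in> ?d a \<inter> ?d b \<inter> ?d c"
      obtain x where x: "x \<noteq> 0" "X = cproj_point x" by (rule cproj_point_exhaust)
      have "x \<in> vec.span {e, a}" "x \<in> vec.span {e, b}"
        using X x ne line by auto
      then obtain k l k' m where "x - k *s e = l *s a" "x - k' *s e = m *s b"
        by (auto simp: vec.span_breakdown_eq [of x] vec.span_singleton)
      then have kl: "x = k *s e + l *s a" "x = k' *s e + m *s b"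
        by (simp_all add: diff_eq_eq add.commute)
      then have "v k l 0 0 = v k' 0 m 0" by (simp add: v_def)
      then have "x = k *s e" using kl by (simp add: v_eq)
      then show "X \<in> {cproj_point e}"
        using x cproj_point_scale [of e k] ne by auto
    qed
  qed
  have on_line: "cproj_point u \<in> ?d u" "cproj_point (u + e) \<in> ?d u" if "u \<noteq> 0" "u + e \<noteq> 0" for u
    using that by (auto simp: cproj_point_in_proj_line_iff intro: vec.span_base)
  have "proj_dim (proj_span (cproj_point ` {a, a + e, b, b + e, c, c + e})) = int (vec.dim {a, a + e, b, b + e, c, c + e}) - 1"
    using ne by (intro proj_dim_proj_span) auto
  also have "vec.dim {a, a + e, b, b + e, c, c + e} = 4"
    using frame vec.dim_span [of "{a, a + e, b, b + e, c, c + e}"] vec.dim_span [of "{e, a, b, c}"]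
    unfolding span_configuration abc frames_def by simp
  finally have dim: "proj_dim (proj_span {cproj_point a, cproj_point (a + e), cproj_point b, cproj_point (b + e),
      cproj_point c, cproj_point (c + e)}) = 3" by simp
  show ?thesis
    unfolding abc configuration_def prod.case
    by (intro desargues3_at_iff [THEN iffD2] conjI insert_subsetI empty_subsetI distinct [folded vs] meet dim
        on_line [OF ne(2,3)] on_line [OF ne(4,5)] on_line [OF ne(6,7)])
qed

lemma desargues3_at_eq:
  assumes e: "e \<noteq> 0"
  shows "desargues3_at (cproj_point e) = configuration e ` frames e"
proof
  show "configuration e ` frames e \<subseteq> desargues3_at (cproj_point e)"
    using configuration_in_desargues3_at by blast
  show "desargues3_at (cproj_point e) \<subseteq> configuration e ` frames e"
  proof
    fix C assume C: "C \<in> desargues3_at (cproj_point e)"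
    obtain A1 B1 A2 B2 A3 B3 where C_eq: "C = (A1, B1, A2, B2, A3, B3)" by (cases C)
    have meet: "proj_line A1 B1 \<inter> proj_line A2 B2 \<inter> proj_line A3 B3 = {cproj_point e}"
      and dim: "proj_dim (proj_span {A1, B1, A2, B2, A3, B3}) = 3"
      using C unfolding C_eq desargues3_at_iff by blast+
    have ne: "A1 \<noteq> B1" "A2 \<noteq> B2" "A3 \<noteq> B3" "A1 \<noteq> cproj_point e" "B1 \<noteq> cproj_point e"
      "A2 \<noteq> cproj_point e" "B2 \<noteq> cproj_point e" "A3 \<noteq> cproj_point e" "B3 \<noteq> cproj_point e"
      using C unfolding C_eq desargues3_at_iff by auto
    have line: "cproj_point e \<in> proj_line A1 B1" "cproj_point e \<in> proj_line A2 B2" "cproj_point e \<in> proj_line A3 B3"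
      using meet by auto
    obtain a where a: "a \<notin> vec.span {e}" "(A1, B1) = pair_of e a"
      using exists_normalised_pair [OF e ne(1,4,5) line(1)] .
    obtain b where b: "b \<notin> vec.span {e}" "(A2, B2) = pair_of e b"
      using exists_normalised_pair [OF e ne(2,6,7) line(2)] .
    obtain c where c: "c \<notin> vec.span {e}" "(A3, B3) = pair_of e c"
      using exists_normalised_pair [OF e ne(3,8,9) line(3)] .
    have C_conf: "C = configuration e (a, b, c)"
      using a b c by (simp add: C_eq configuration_def pair_of_def)
    have "proj_dim (proj_span (cproj_point ` {a, a + e, b, b + e, c, c + e})) = int (vec.dim {a, a + e, b, b + e, c, c + e}) - 1"
      using not_in_span_singleton [OF a(1)] not_in_span_singleton [OF b(1)] not_in_span_singleton [OF c(1)]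
      by (intro proj_dim_proj_span) auto
    moreover have "cproj_point ` {a, a + e, b, b + e, c, c + e} = {A1, B1, A2, B2, A3, B3}"
      using a b c by (simp add: pair_of_def)
    ultimately have "vec.dim {a, a + e, b, b + e, c, c + e} = 4"
      using dim by simp
    then have "(a, b, c) \<in> frames e"
      using vec.dim_span [of "{a, a + e, b, b + e, c, c + e}"] vec.dim_span [of "{e, a, b, c}"]
      unfolding span_configuration frames_def by simp
    then show "C \<in> configuration e ` frames e" using C_conf by blast
  qed
qed

lemma directions_configuration:
  assumes e: "e \<noteq> 0" and m: "m \<in> frames e"
  shows "directions e (configuration e m) = m"
proof -
  obtain a b c where "m = (a, b, c)" by (cases m)
  then show ?thesis
    using frames_not_in_span [of a b c e] m normalise_pair_of [OF e, unfolded pair_of_def]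
    by (simp add: configuration_def directions_def)
qed

lemma continuous_configuration: "continuous_on (frames e) (configuration e)"
proof -
  have cont: "continuous_on (frames e) (\<lambda>m. cproj_point (h m))"
    if "continuous_on (frames e) h" "\<And>m. m \<in> frames e \<Longrightarrow> h m \<noteq> 0" for h
    using that by (intro continuous_on_compose2 [OF continuous_cproj_point]) auto
  have nonzero: "fst m \<noteq> 0" "fst (snd m) \<noteq> 0" "snd (snd m) \<noteq> 0"
    "fst m + e \<noteq> 0" "fst (snd m) + e \<noteq> 0" "snd (snd m) + e \<noteq> 0" if "m \<in> frames e" for m
    using frames_not_in_span [of "fst m" "fst (snd m)" "snd (snd m)" e] that not_in_span_singleton [of _ e]
    by auto
  show ?thesis
    unfolding configuration_def case_prod_unfold
    by (intro continuous_on_Pair cont nonzero continuous_on_add continuous_on_fst continuous_on_snd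
        continuous_on_id continuous_on_const)
qed

lemma continuous_directions:
  assumes e: "e \<noteq> 0"
  shows "continuous_on (desargues3_at (cproj_point e)) (directions e)"
proof -
  let ?D = "desargues3_at (cproj_point e)"
  have cont: "continuous_on ?D (\<lambda>C. normalise e (h C))"
    if "continuous_on ?D h" "\<And>C. C \<in> ?D \<Longrightarrow> h C \<in> pair_of e ` (- vec.span {e})" for h
    using that by (intro continuous_on_compose2 [OF continuous_normalise [OF e]]) auto
  have pairs: "(fst C, fst (snd C)) \<in> pair_of e ` (- vec.span {e})"
    "(fst (snd (snd C)), fst (snd (snd (snd C)))) \<in> pair_of e ` (- vec.span {e})"
    "(fst (snd (snd (snd (snd C)))), snd (snd (snd (snd (snd C))))) \<in> pair_of e ` (- vec.span {e})"
    if C: "C \<in> ?D" for C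
  proof -
    obtain a b c where "(a, b, c) \<in> frames e" "C = configuration e (a, b, c)"
      using C unfolding desargues3_at_eq [OF e] by auto
    then show "(fst C, fst (snd C)) \<in> pair_of e ` (- vec.span {e})"
      "(fst (snd (snd C)), fst (snd (snd (snd C)))) \<in> pair_of e ` (- vec.span {e})"
      "(fst (snd (snd (snd (snd C)))), snd (snd (snd (snd (snd C))))) \<in> pair_of e ` (- vec.span {e})"
      using frames_not_in_span [of a b c e] by (auto simp: configuration_def pair_of_def)
  qed
  show ?thesis
    unfolding directions_def case_prod_unfold
    by (intro continuous_on_Pair cont pairs continuous_on_fst continuous_on_snd continuous_on_id)
qed

section \<open>The fundamental group of the space of configurations\<close>

theorem theorem1p4:
  fixes n :: nat and I :: "'n::finite cproj" and c :: "'n six_points"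
  assumes "CARD('n) = n + 1" and "n \<ge> 3"
    and "c \<in> desargues3_at I"
  shows "(n = 3 \<longrightarrow> fundamental_group (desargues3_at I) c \<cong> integer_group) \<and>
         (n \<ge> 4 \<longrightarrow> trivial_group (fundamental_group (desargues3_at I) c))"
proof -
  obtain e where e: "e \<noteq> 0" and I: "I = cproj_point e" by (rule cproj_point_exhaust)
  let ?D = "desargues3_at I" and ?f = "configuration e" and ?g = "directions e"
  have D: "?D = ?f ` frames e"
    unfolding I by (rule desargues3_at_eq [OF e])
  have gf: "?g (?f m) = m" if "m \<in> frames e" for m
    using directions_configuration [OF e that] .
  have f: "continuous_on (frames e) ?f" "?f ` frames e \<subseteq> ?D"
    using continuous_configuration D by auto
  have g: "continuous_on ?D ?g" "?g ` ?D \<subseteq> frames e"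
    using continuous_directions [OF e] gf unfolding I [symmetric] D by auto
  have fg: "?f (?g x) = x" if "x \<in> ?D" for x
    using that gf unfolding D by auto
  have lift: "path (?g \<circ> p)" "path_image (?g \<circ> p) \<subseteq> frames e" "pathstart (?g \<circ> p) = ?g c" "pathfinish (?g \<circ> p) = ?g c"
    if "p \<in> loops_at ?D c" for p
    using that g by (auto simp: loops_at_iff pathstart_compose pathfinish_compose path_image_compose
        intro!: path_continuous_image elim: continuous_on_subset)
  have homotopic_if_null: "homotopic_paths ?D p q"
    if "p \<in> loops_at ?D c" "q \<in> loops_at ?D c"
      and null: "\<exists>m. homotopic_loops (frames e) ((?g \<circ> p) +++ reversepath (?g \<circ> q)) (\<lambda>_. m)" for p q
  proof (rule homotopic_paths_if_image_homotopic [OF g f fg])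
    show "homotopic_paths (frames e) (?g \<circ> p) (?g \<circ> q)"
      using null lift(1) [OF that(2)] homotopic_paths_if_difference_null by blast
  qed (use that in \<open>auto simp: loops_at_iff\<close>)
  have difference: "path ((?g \<circ> p) +++ reversepath (?g \<circ> q))"
      "path_image ((?g \<circ> p) +++ reversepath (?g \<circ> q)) \<subseteq> frames e"
      "pathfinish ((?g \<circ> p) +++ reversepath (?g \<circ> q)) = pathstart ((?g \<circ> p) +++ reversepath (?g \<circ> q))"
    if "p \<in> loops_at ?D c" "q \<in> loops_at ?D c" for p q
    using lift [OF that(1)] lift [OF that(2)] by (simp_all add: subset_path_image_join)
  have "fundamental_group ?D c \<cong> integer_group" if "n = 3"
  proof -
    have "CARD('n) = 4" using that assms(1) by simp
    then obtain vol where "frame_volume e vol" using exists_frame_volume by blast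
    then interpret frame_volume e vol .
    have vol_frames: "continuous_on (frames e) vol" "vol ` frames e \<subseteq> - {0}"
      using vol_continuous vol_nonzero by (auto elim: continuous_on_subset)
    show ?thesis
    proof (rule fundamental_group_iso_integer_group)
      show "continuous_on ?D (vol \<circ> ?g)"
        by (intro continuous_on_compose g continuous_on_subset [OF vol_frames(1)])
      show "(vol \<circ> ?g) ` ?D \<subseteq> - {0}"
        using g(2) vol_frames(2) by auto
    next
      fix p q assume pq: "p \<in> loops_at ?D c" "q \<in> loops_at ?D c"
        and winding: "winding_number (vol \<circ> ?g \<circ> p) 0 = winding_number (vol \<circ> ?g \<circ> q) 0"
      have vol_lift: "path (vol \<circ> (?g \<circ> r))" "0 \<notin> path_image (vol \<circ> (?g \<circ> r))"
        "pathfinish (vol \<circ> (?g \<circ> r)) = vol (?g c)" if "r \<in> loops_at ?D c" for r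
        using lift [OF that] vol_frames
        by (auto simp: path_image_compose pathfinish_compose intro!: path_continuous_image elim: continuous_on_subset)
      have "winding_number (vol \<circ> ((?g \<circ> p) +++ reversepath (?g \<circ> q))) 0 = 0"
        using winding vol_lift [OF pq(1)] vol_lift [OF pq(2)]
        by (simp add: path_compose_join path_compose_reversepath winding_number_join
            winding_number_reversepath o_assoc)
      then show "homotopic_paths ?D p q"
        using homotopic_if_null [OF pq] null_homotopic_if_winding_zero difference [OF pq] by blast
    next
      fix k :: int
      obtain x y z where xyz: "?g c = (x, y, z)" by (cases "?g c")
      then have frame: "(x, y, z) \<in> frames e" using g(2) assms(3) by force
      \<comment> \<open>Writing the volume as an exponential makes the loop of volumes the exponential of an affine path.\<close>
      obtain l where l: "vol (x, y, z) = exp l" using vol_nonzero [OF frame] by (metis exp_Ln)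
      define s where "s t = 2 * of_real pi * \<i> * of_int k * complex_of_real t" for t
      define r where "r t = (exp (s t) *s x, y, z)" for t
      have r_frames: "r t \<in> frames e" for t
        unfolding r_def by (rule frames_scale_first [OF frame]) simp
      have s_cont: "continuous_on {0..1} s" unfolding s_def by (intro continuous_intros)
      have ends: "r 0 = ?g c" "r 1 = ?g c"
      proof -
        have "exp (s 1) = 1" unfolding s_def exp_eq_1 by (auto simp: mult_ac)
        then show "r 1 = ?g c" by (simp add: r_def xyz)
      qed (simp add: r_def s_def xyz)
      have "path r"
        unfolding path_def r_def using s_cont by (intro continuous_intros continuous_smult)
      then have "path (?f \<circ> r)"
        using f(1) r_frames by (intro path_continuous_image) (auto simp: path_image_def elim: continuous_on_subset)
      then have "?f \<circ> r \<in> loops_at ?D c"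
        using r_frames f(2) ends fg [OF assms(3)]
        by (auto simp: loops_at_iff path_image_def pathstart_def pathfinish_def)
      moreover have "winding_number (vol \<circ> ?g \<circ> (?f \<circ> r)) 0 = of_int k"
      proof -
        have "vol (exp (s t) *s x, y, z) = exp (s t + l)" for t
          using vol_first [of 0 y z "exp (s t)" x] l by (simp add: vec.span_zero exp_add)
        then have "vol \<circ> ?g \<circ> (?f \<circ> r) = exp \<circ> (\<lambda>t. s t + l)"
          using gf [OF r_frames] by (simp add: fun_eq_iff) (simp add: r_def)
        moreover have "path (\<lambda>t. s t + l)"
          unfolding path_def using s_cont by (intro continuous_intros)
        ultimately show ?thesis
          by (simp add: winding_number_compose_exp pathstart_def pathfinish_def s_def)
      qed
      ultimately show "\<exists>p\<in>loops_at ?D c. winding_number (vol \<circ> ?g \<circ> p) 0 = of_int k" by blast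
    qed
  qed
  moreover have "trivial_group (fundamental_group ?D c)" if "n \<ge> 4"
  proof (rule trivial_fundamental_group [OF assms(3)])
    have "CARD('n) > 4" using that assms(1) by simp
    then show "homotopic_paths ?D p q" if "p \<in> loops_at ?D c" "q \<in> loops_at ?D c" for p q
      using homotopic_if_null [OF that] loop_in_frames_null_homotopic difference [OF that] by blast
  qed
  ultimately show ?thesis by blast
qed

end
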